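(* Let $n\ge1$ and $\bm r\in\mathbb R^n$. For the canonical probe $|\psi_{\bm r}\rangle$, the passive Fisher matrix is diagonal in the physical passive basis $\{\hat g_j^{\mathrm{rot}}\}_{j}\cup\{\hat g_{jk}^{\mathrm{bsX}},\hat g_{jk}^{\mathrm{bsY}}\}_{j<k}$, with diagonal entries $$F_j^{\mathrm{rot}}=2\sinh^2(2r_j)\quad(1\le j\le n),$$ $$F_{jk}^{\mathrm{bsY}}=4\sinh^2(r_j-r_k),\qquad F_{jk}^{\mathrm{bsX}}=4\sinh^2(r_j+r_k)\quad(1\le j<k\le n).$$ Equivalently, labelling the generators by positive restricted roots $\bm\alpha\in\Sigma_+$, the diagonal entries are $F_{\bm\alpha}(\bm r)=c_{\bm\alpha}\sinh^2[\bm\alpha(\bm r)]$ with $c_{2\bm e_j}=2$ and $c_{\bm e_j\pm\bm e_k}=4$.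
   Context: Bosonic modes: on the Fock space of $n$ bosonic modes let $\hat a_j,\hat a_j^\dagger$ be the annihilation and creation operators, $[\hat a_j,\hat a_k^\dagger]=\delta_{jk}$, and $|0\rangle$ the vacuum. For $\bm r=(r_1,\dots,r_n)\in\mathbb R^n$ the canonical probe is $|\psi_{\bm r}\rangle=\hat S(\bm r)|0\rangle$ with $\hat S(\bm r)=\prod_{j=1}^n \exp\!\big[\tfrac12 r_j(\hat a_j^2-\hat a_j^{\dagger 2})\big]$. Passive generators ($n^2$ in total): $\hat g_j^{\mathrm{rot}}=\hat a_j^\dagger\hat a_j$ for $1\le j\le n$; $\hat g_{jk}^{\mathrm{bsX}}=\hat a_j^\dagger\hat a_k+\hat a_k^\dagger\hat a_j$ and $\hat g_{jk}^{\mathrm{bsY}}=-i(\hat a_j^\dagger\hat a_k-\hat a_k^\dagger\hat a_j)$ for $1\le j<k\le n$. Denote them $\hat g_1,\dots,\hat g_{n^2}$. Passive Fisher matrix: $F_{\mu\nu}=2\langle\{\Delta\hat g_\mu,\Delta\hat g_\nu\}\rangle$, with $\Delta\hat g_\mu=\hat g_\mu-\langle\hat g_\mu\rangle$, $\{\cdot,\cdot\}$ the anticommutator and expectation values in $|\psi_{\bm r}\rangle$. This is the quantum Fisher information matrix at $\bm\theta=\bm 0$ of the family $e^{-i\sum_\mu\theta_\mu\hat g_\mu}|\psi_{\bm r}\rangle$. Positive restricted roots (type $C_n$): with linear forms $\bm e_j(\bm r)=r_j$, $\Sigma_+=\{2\bm e_j\}_{j=1}^n\cup\{\bm e_j-\bm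 e_k,\ \bm e_j+\bm e_k\}_{1\le j<k\le n}$, with labelling $2\bm e_j\leftrightarrow\hat g_j^{\mathrm{rot}}$, $\bm e_j-\bm e_k\leftrightarrow\hat g_{jk}^{\mathrm{bsY}}$, $\bm e_j+\bm e_k\leftrightarrow\hat g_{jk}^{\mathrm{bsX}}$. *)

theory Defs
  imports "HOL-Analysis.Analysis"
begin

text \<open>
  The modes are indexed by a finite linearly ordered type \<open>'n\<close>, so the number of modes is
  \<open>n = CARD('n) \<ge> 1\<close>. A vector is represented by its coefficients in the occupation-number basis
  \<open>|m\<rangle>\<close>, where \<open>m j\<close> is the number of bosons in mode \<open>j\<close>.
\<close>

type_synonym 'n state = "('n \<Rightarrow> nat) \<Rightarrow> complex"
type_synonym 'n op = "'n state \<Rightarrow> 'n state"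

definition fock :: "'n state set" where
  "fock = {\<psi>. (\<lambda>m. (cmod (\<psi> m))\<^sup>2) summable_on UNIV}"

definition fock_norm :: "'n state \<Rightarrow> real" where
  "fock_norm \<psi> = sqrt (\<Sum>\<^sub>\<infinity>m. (cmod (\<psi> m))\<^sup>2)"

definition braket :: "'n state \<Rightarrow> 'n state \<Rightarrow> complex" where
  "braket \<phi> \<psi> = (\<Sum>\<^sub>\<infinity>m. cnj (\<phi> m) * \<psi> m)"

definition vacuum :: "'n state" where
  "vacuum m = (if m = (\<lambda>_. 0) then 1 else 0)"

text \<open>
  The ladder operators, from \<open>a\<^sub>j |m\<rangle> = sqrt (m j) |m - 1\<^sub>j\<rangle>\<close> and
  \<open>a\<^sub>j\<^sup>\<dagger> |m\<rangle> = sqrt (m j + 1) |m + 1\<^sub>j\<rangle>\<close>. Each coefficient of the result involves a single coefficient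
  of the argument, so the formulas make sense for arbitrary coefficient families; the domain of the
  unbounded operator consists of the vectors in \<^const>\<open>fock\<close> whose image is again in \<^const>\<open>fock\<close>.
  For \<open>m j = 0\<close> the truncated subtraction in \<open>cre\<close> is harmless because of the factor \<open>sqrt 0\<close>.
\<close>

definition ann :: "'n \<Rightarrow> 'n op" where
  "ann j \<psi> m = of_real (sqrt (real (m j + 1))) * \<psi> (m(j := m j + 1))"

definition cre :: "'n \<Rightarrow> 'n op" where
  "cre j \<psi> m = of_real (sqrt (real (m j))) * \<psi> (m(j := m j - 1))"

lemma canonical_commutation:
  "ann j (cre k \<psi>) m - cre k (ann j \<psi>) m = (if j = k then \<psi> m else 0)"
proof (cases "j = k")
  case True
  have sq: "complex_of_real (sqrt (real i)) * (complex_of_real (sqrt (real i)) * z) = of_nat i * z"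
    for i z
  proof -
    have "complex_of_real (sqrt (real i)) * complex_of_real (sqrt (real i)) = of_nat i"
      by (simp flip: of_real_mult)
    then show ?thesis by (simp flip: mult.assoc)
  qed
  have "m(k := i) = m" if "m k = i" for i
    using that by auto
  then show ?thesis
    using True by (cases "m k") (simp_all add: ann_def cre_def sq del: of_nat_Suc, simp add: algebra_simps)
next
  case False
  then show ?thesis
    by (simp add: ann_def cre_def fun_upd_twist)
qed

text \<open>
  \<open>is_flow A \<psi> u\<close> says that \<open>u\<close> is the orbit \<open>t \<mapsto> e\<^sup>t\<^sup>A \<psi>\<close>: the norm-continuous curve in the Fock
  space that starts at \<open>\<psi>\<close> and solves \<open>u' = A u\<close> weakly, that is, tested against the number states.
  The operators exponentiated here are essentially skew-adjoint on the finite-particle vectors, so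
  for every \<open>\<psi>\<close> in the Fock space such a curve exists, is unique, and is the orbit of \<open>\<psi>\<close> under the
  unitary group with generator \<open>A\<close> given by Stone's theorem. The power series of \<open>e\<^sup>A\<close> cannot serve
  as the definition: on the vacuum it diverges for large squeezing parameters.
\<close>

definition is_flow :: "'n op \<Rightarrow> 'n state \<Rightarrow> (real \<Rightarrow> 'n state) \<Rightarrow> bool" where
  "is_flow A \<psi> u \<longleftrightarrow>
     u 0 = \<psi> \<and> (\<forall>t. u t \<in> fock) \<and>
     (\<forall>t. ((\<lambda>s. fock_norm (\<lambda>m. u s m - u t m)) \<longlongrightarrow> 0) (at t)) \<and>
     (\<forall>t m. ((\<lambda>s. u s m) has_vector_derivative A (u t) m) (at t))"

definition exp_op :: "'n op \<Rightarrow> 'n op" where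
  "exp_op A \<psi> = (THE \<phi>. \<exists>u. is_flow A \<psi> u \<and> u 1 = \<phi>)"

definition squeeze_gen :: "real ^ 'n \<Rightarrow> 'n \<Rightarrow> 'n op" where
  "squeeze_gen r j \<psi> m = of_real (1/2 * r $ j) * (ann j (ann j \<psi>) m - cre j (cre j \<psi>) m)"

definition squeeze :: "real ^ 'n::{finite,linorder} \<Rightarrow> 'n op" where
  "squeeze r = foldr (\<lambda>j S. exp_op (squeeze_gen r j) \<circ> S) (sorted_list_of_set UNIV) id"

definition probe :: "real ^ 'n::{finite,linorder} \<Rightarrow> 'n state" where
  "probe r = squeeze r vacuum"

datatype 'n passive_gen = Rot 'n | BsX 'n 'n | BsY 'n 'n

definition passive_basis :: "'n::linorder passive_gen set" where
  "passive_basis = range Rot \<union> {BsX j k | j k. j < k} \<union> {BsY j k | j k. j < k}"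

fun passive_op :: "'n passive_gen \<Rightarrow> 'n op" where
  "passive_op (Rot j) \<psi> m = cre j (ann j \<psi>) m"
| "passive_op (BsX j k) \<psi> m = cre j (ann k \<psi>) m + cre k (ann j \<psi>) m"
| "passive_op (BsY j k) \<psi> m = - \<i> * (cre j (ann k \<psi>) m - cre k (ann j \<psi>) m)"

definition expectation :: "'n state \<Rightarrow> 'n op \<Rightarrow> complex" where
  "expectation \<psi> G = braket \<psi> (G \<psi>)"

definition fluctuation :: "'n state \<Rightarrow> 'n op \<Rightarrow> 'n op" where
  "fluctuation \<psi> G \<phi> m = G \<phi> m - expectation \<psi> G * \<phi> m"

definition anticommutator :: "'n op \<Rightarrow> 'n op \<Rightarrow> 'n op" where
  "anticommutator A B \<phi> m = A (B \<phi>) m + B (A \<phi>) m"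

definition passive_fisher ::
  "real ^ 'n::{finite,linorder} \<Rightarrow> 'n passive_gen \<Rightarrow> 'n passive_gen \<Rightarrow> complex" where
  "passive_fisher r \<mu> \<nu> =
     2 * expectation (probe r)
           (anticommutator (fluctuation (probe r) (passive_op \<mu>))
                           (fluctuation (probe r) (passive_op \<nu>)))"

definition long_root :: "'n \<Rightarrow> real ^ 'n \<Rightarrow> real" where
  "long_root j = (\<lambda>r. 2 * r $ j)"

definition diff_root :: "'n \<Rightarrow> 'n \<Rightarrow> real ^ 'n \<Rightarrow> real" where
  "diff_root j k = (\<lambda>r. r $ j - r $ k)"

definition sum_root :: "'n \<Rightarrow> 'n \<Rightarrow> real ^ 'n \<Rightarrow> real" where
  "sum_root j k = (\<lambda>r. r $ j + r $ k)"

definition positive_roots :: "(real ^ 'n::{finite,linorder} \<Rightarrow> real) set" where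
  "positive_roots = range long_root \<union> {diff_root j k | j k. j < k} \<union> {sum_root j k | j k. j < k}"

fun root_of :: "'n passive_gen \<Rightarrow> real ^ 'n \<Rightarrow> real" where
  "root_of (Rot j) = long_root j"
| "root_of (BsX j k) = sum_root j k"
| "root_of (BsY j k) = diff_root j k"

definition gen_of_root :: "(real ^ 'n::{finite,linorder} \<Rightarrow> real) \<Rightarrow> 'n passive_gen" where
  "gen_of_root = the_inv_into passive_basis root_of"

definition root_fisher :: "(real ^ 'n::{finite,linorder} \<Rightarrow> real) \<Rightarrow> real ^ 'n::{finite,linorder} \<Rightarrow> complex" where
  "root_fisher \<alpha> r = passive_fisher r (gen_of_root \<alpha>) (gen_of_root \<alpha>)"

definition root_coeff :: "(real ^ 'n \<Rightarrow> real) \<Rightarrow> real" where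
  "root_coeff \<alpha> = (if \<alpha> \<in> range long_root then 2 else 4)"

end

theory Submission imports Defs begin

text \<open>
  The squeezed vacuum of one mode has an explicit number-state expansion, and its coefficients solve
  the evolution equation of the squeezing generator. A truncation argument shows that weak solutions
  of this equation are unique, so the canonical probe is the product of the one-mode squeezed vacua.

  That product is annihilated by \<open>a\<^sub>j + tanh (r\<^sub>j) a\<^sub>j\<^sup>\<dagger>\<close>. Together with the canonical
  commutation relations, this fixes all expectation values of polynomials in the ladder operators:
  each passive generator is a combination of the bilinears \<open>a\<^sub>j\<^sup>\<dagger> a\<^sub>k\<close>, and Wick's theorem gives
  their covariances, which are supported on equal or swapped index pairs.
\<close>

section \<open>Squeezed vacuum of a single mode\<close>

text \<open>\<open>exp_op\<close> selects the endpoint of a flow by definite description, so nothing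
  can be computed before uniqueness is known. The generator is unbounded and the flow equation holds
  only coefficient by coefficient, so the norm of a difference of flows cannot simply be
  differentiated. A cut-off norm with finitely many terms can, and skew-symmetry leaves only the
  increments of the cut-off. For expectation values the obstacle is convergence: adjointness of
  \<open>ann\<close> and \<open>cre\<close> is mere reindexing, but additivity of
  \<open>braket\<close> needs summability, supplied by geometric decay, which the ladder operators
  preserve. Moments are not summed explicitly: moving a ladder operator once around the expectation
  value gives a linear equation with factor 1 - tanh^2 = 1/cosh^2. For a pair j, k the surviving
  contractions form the square of sinh r_j cosh r_k plus or minus cosh r_j sinh r_k, and the
  addition theorem produces the root r_j + r_k or r_j - r_k.\<close>

primrec sqz_wt :: "nat \<Rightarrow> real" where
  "sqz_wt 0 = 1"
| "sqz_wt (Suc n) = sqz_wt n * sqrt (real (2 * n + 1) / real (2 * n + 2))"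

text \<open>Since \<open>sqz_wt n\<close> equals sqrt((2n)!) / (2^n n!), this is the textbook
  amplitude of the squeezed vacuum. Bosons are created in pairs, hence only even levels.\<close>

definition sqz :: "real \<Rightarrow> nat \<Rightarrow> real" where
  "sqz s k = (if even k then sqz_wt (k div 2) * (- tanh s) ^ (k div 2) / sqrt (cosh s) else 0)"

lemma sqz_0: "sqz 0 k = (if k = 0 then 1 else 0)"
  by (auto simp: sqz_def power_0_left elim: evenE)

lemma sqz_wt_bounds: "0 \<le> sqz_wt n" "sqz_wt n \<le> 1"
proof -
  have "0 \<le> sqz_wt n \<and> sqz_wt n \<le> 1"
  proof (induction n)
    case (Suc n)
    have "sqrt (real (2 * n + 1) / real (2 * n + 2)) \<le> 1"
      by simp
    with Suc show ?case
      by (auto intro!: mult_le_one)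
  qed simp
  then show "0 \<le> sqz_wt n" "sqz_wt n \<le> 1" by auto
qed

lemma sqz_wt_Suc: "sqrt (real (2 * n + 2)) * sqz_wt (Suc n) = sqrt (real (2 * n + 1)) * sqz_wt n"
  by (simp add: real_sqrt_divide)

text \<open>These are the Taylor coefficients of (1 - x)^(-1/2), which turns overlaps into binomial
  series.\<close>

lemma sqz_wt_square: "(sqz_wt n)\<^sup>2 = (- 1) ^ n * ((- 1 / 2) gchoose n)"
proof (induction n)
  case (Suc n)
  have "(- 1 / 2) gchoose (Suc n) = ((- 1 / 2) gchoose n) * ((- 1 / 2 - real n) / real (Suc n))"
    using gbinomial_mult_1[of "- 1 / 2 :: real" n] by (simp add: field_simps)
  also have "(- 1 / 2 - real n) / real (Suc n) = - (real (2 * n + 1) / real (2 * n + 2))"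
    by (simp add: field_simps)
  finally show ?case
    using Suc by (simp add: power_mult_distrib)
qed simp

text \<open>Coefficient form of annihilation by a + tanh(s) a^dagger. At k = 0 the truncated index k
  - 1 is harmless because of the factor sqrt 0.\<close>

lemma sqz_Suc: "sqrt (real (k + 1)) * sqz s (Suc k) = - tanh s * (sqrt (real k) * sqz s (k - 1))"
proof (cases k)
  case 0
  then show ?thesis by (simp add: sqz_def)
next
  case (Suc i)
  show ?thesis
  proof (cases "even i")
    case True
    then obtain n where n: "i = 2 * n" by (elim evenE)
    have "sqrt (real (k + 1)) * sqz s (Suc k)
        = (sqrt (real (2 * n + 2)) * sqz_wt (Suc n)) * (- tanh s) ^ Suc n / sqrt (cosh s)"
      using Suc n by (simp add: sqz_def ac_simps del: sqz_wt.simps)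
    also have "\<dots> = - tanh s * (sqrt (real k) * sqz s (k - 1))"
      unfolding sqz_wt_Suc using Suc n by (simp add: sqz_def ac_simps)
    finally show ?thesis .
  qed (simp add: Suc sqz_def)
qed

lemma abs_tanh_less_1: "\<bar>tanh (x::real)\<bar> < 1"
  using tanh_real_bounds[of x] by (auto simp: abs_less_iff)

text \<open>Each pair of bosons costs a factor |tanh s|, hence its square root per boson; the weight
  and the normalisation are at most 1.\<close>

lemma abs_sqz_le: "\<bar>sqz s k\<bar> \<le> sqrt \<bar>tanh s\<bar> ^ k"
proof (cases "even k")
  case True
  then obtain n where n: "k = 2 * n" by (elim evenE)
  have "\<bar>sqz s k\<bar> = sqz_wt n * \<bar>tanh s\<bar> ^ n / sqrt (cosh s)"
    using sqz_wt_bounds(1)[of n] by (simp add: sqz_def n abs_mult power_abs)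
  also have "\<dots> \<le> sqz_wt n * \<bar>tanh s\<bar> ^ n"
    using sqz_wt_bounds(1)[of n] cosh_real_ge_1[of s]
      frac_le[of "sqz_wt n * \<bar>tanh s\<bar> ^ n" "sqz_wt n * \<bar>tanh s\<bar> ^ n" 1 "sqrt (cosh s)"]
    by simp
  also have "\<dots> \<le> \<bar>tanh s\<bar> ^ n"
    using sqz_wt_bounds[of n] by (intro mult_left_le_one_le) auto
  finally show ?thesis
    by (simp add: n power_mult)
qed (simp add: sqz_def)

text \<open>The even terms sum to (1 - x)^(-1/2) at x = tanh s tanh t, and 1 - x = cosh (s - t) /
  (cosh s cosh t). Taking s = t gives normalisation, distinct parameters give norm continuity of the
  flow.\<close>

lemma sqz_inner:
  "(\<lambda>k. \<bar>sqz s k * sqz t k\<bar>) summable_on UNIV"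
  "(\<Sum>\<^sub>\<infinity>k. sqz s k * sqz t k) = 1 / sqrt (cosh (s - t))"
proof -
  let ?c = "1 / (sqrt (cosh s) * sqrt (cosh t))"
  let ?x = "tanh s * tanh t"
  let ?f = "\<lambda>k. sqz s k * sqz t k"
  have x: "\<bar>?x\<bar> < 1"
    using mult_strict_mono'[OF abs_tanh_less_1[of s] abs_tanh_less_1[of t]] by (simp add: abs_mult)
  have f: "?f (2 * n) = ?c * (((- 1 / 2) gchoose n) * (- ?x) ^ n)" for n
  proof -
    have "?f (2 * n) = ?c * ((sqz_wt n)\<^sup>2 * ?x ^ n)"
      by (simp add: sqz_def power2_eq_square power_mult_distrib flip: power_mult_distrib)
    also have "(sqz_wt n)\<^sup>2 * ?x ^ n = ((- 1 / 2) gchoose n) * (- ?x) ^ n"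
      unfolding sqz_wt_square power_minus[of ?x] by simp
    finally show ?thesis .
  qed
  have pos: "0 < cosh s" "0 < cosh t" "0 < cosh (s - t)" by simp_all
  have "1 - ?x = cosh (s - t) / (cosh s * cosh t)"
    using pos by (simp add: cosh_diff tanh_def field_simps)
  then have "sqrt (1 - ?x) = sqrt (cosh (s - t)) / (sqrt (cosh s) * sqrt (cosh t))"
    by (simp add: real_sqrt_divide real_sqrt_mult)
  moreover have "(1 - ?x) powr (- 1 / 2) = 1 / sqrt (1 - ?x)"
    using x by (simp add: powr_minus powr_half_sqrt field_simps)
  ultimately have "?c * (1 - ?x) powr (- 1 / 2) = 1 / sqrt (cosh (s - t))"
    using pos by simp
  moreover have "(\<lambda>n. ((- 1 / 2) gchoose n) * (- ?x) ^ n) sums (1 - ?x) powr (- 1 / 2)"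
    using gen_binomial_real[of "- ?x" "- 1 / 2"] x by simp
  ultimately have sums: "(\<lambda>n. ?f (2 * n)) sums (1 / sqrt (cosh (s - t)))"
    unfolding f by (simp only: sums_mult flip: \<open>?c * (1 - ?x) powr (- 1 / 2) = _\<close>)
  \<comment> \<open>Passing from the ordered series to an unordered sum needs absolute
    convergence.\<close>
  have "summable (\<lambda>n. \<bar>?x\<bar> ^ n)"
    using x by (intro summable_geometric) simp
  moreover have "norm (norm (?f (2 * n))) \<le> \<bar>?x\<bar> ^ n" for n
  proof -
    have "\<bar>?f (2 * n)\<bar> \<le> sqrt \<bar>tanh s\<bar> ^ (2 * n) * sqrt \<bar>tanh t\<bar> ^ (2 * n)"
      unfolding abs_mult by (intro mult_mono abs_sqz_le) auto
    then show ?thesis by (simp add: power_mult abs_mult power_mult_distrib)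
  qed
  ultimately have summ: "summable (\<lambda>n. norm (?f (2 * n)))"
    by (rule summable_comparison_test'[where N = 0])
  from norm_summable_imp_has_sum[OF summ sums]
  have hs: "((\<lambda>n. ?f (2 * n)) has_sum (1 / sqrt (cosh (s - t)))) UNIV" .
  have inj: "inj ((*) (2::nat))" by (auto intro: injI)
  have odd: "sqz s k = 0" if "k \<notin> range ((*) 2)" for k
    using that by (auto simp: sqz_def elim!: evenE)
  have "(?f has_sum (1 / sqrt (cosh (s - t)))) (range ((*) 2))"
    using hs by (subst has_sum_reindex[OF inj]) (simp add: o_def)
  then have "(?f has_sum (1 / sqrt (cosh (s - t)))) UNIV"
    by (rule has_sum_cong_neutral[THEN iffD1, rotated -1]) (auto simp: odd)
  then show "(\<Sum>\<^sub>\<infinity>k. ?f k) = 1 / sqrt (cosh (s - t))" "(\<lambda>k. \<bar>?f k\<bar>) summable_on UNIV"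
    using summable_on_iff_abs_summable_on_real[of ?f UNIV] by (auto intro: infsumI has_sum_imp_summable)
qed

text \<open>With T = - tanh s and k = 2n, differentiating T^n / sqrt (cosh s) yields only the powers
  n + 1 and n - 1 of T, which belong to the levels k + 2 and k - 2.\<close>

lemma sqz_has_derivative:
  "((\<lambda>s. sqz s k) has_real_derivative
     (sqrt (real ((k + 1) * (k + 2))) * sqz s (k + 2) - sqrt (real (k * (k - 1))) * sqz s (k - 2)) / 2) (at s)"
proof (cases "even k")
  case True
  then obtain n where n: "k = 2 * n" by (elim evenE)
  let ?T = "- tanh s"
  let ?C = "sqz_wt n / sqrt (cosh s)"
  have pos: "0 < cosh s" by simp
  have D: "((\<lambda>s. sqz_wt n * (- tanh s) ^ n / sqrt (cosh s)) has_real_derivative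
      (?C * (?T ^ Suc n / 2 - real n * ?T ^ (n - 1) * (1 - (tanh s)\<^sup>2)))) (at s)"
  proof -
    have dT: "((\<lambda>s. - tanh s) has_real_derivative - (1 - (tanh s)\<^sup>2)) (at s)"
      by (auto intro!: derivative_eq_intros)
    have dC: "((\<lambda>s. 1 / sqrt (cosh s)) has_real_derivative (?T / (2 * sqrt (cosh s)))) (at s)"
    proof -
      have "((\<lambda>s. inverse (sqrt (cosh s))) has_real_derivative
          - (inverse (sqrt (cosh s)) * (inverse (sqrt (cosh s)) / 2 * sinh s) * inverse (sqrt (cosh s)))) (at s)"
        using pos by (intro DERIV_inverse' DERIV_chain2[OF DERIV_real_sqrt] DERIV_ident[THEN has_field_derivative_cosh, simplified])
            auto
      moreover have "- (inverse q * (inverse q / 2 * x) * inverse q) = - (x / (q * q)) / (2 * q)" for q x :: real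
        by (simp add: field_simps)
      ultimately have "((\<lambda>s. inverse (sqrt (cosh s))) has_real_derivative
          - (sinh s / (sqrt (cosh s) * sqrt (cosh s))) / (2 * sqrt (cosh s))) (at s)"
        by (simp only:)
      then show ?thesis
        by (simp add: tanh_def inverse_eq_divide)
    qed
    have "((\<lambda>s. sqz_wt n * ((- tanh s) ^ n * (1 / sqrt (cosh s)))) has_real_derivative
      sqz_wt n * (?T ^ n * (?T / (2 * sqrt (cosh s)))
        + real n * (- (1 - (tanh s)\<^sup>2) * ?T ^ (n - Suc 0)) * (1 / sqrt (cosh s)))) (at s)"
      by (intro DERIV_cmult DERIV_mult' DERIV_power dT dC)
    then show ?thesis
      by (simp add: algebra_simps)
  qed
  have up: "sqrt (real ((k + 1) * (k + 2))) * sqz s (k + 2) = ?C * (real (k + 1) * ?T ^ Suc n)"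
  proof -
    have "sqrt (real ((k + 1) * (k + 2))) * sqz s (k + 2)
        = sqrt (real (k + 1)) * (sqrt (real (k + 1 + 1)) * sqz s (Suc (k + 1)))"
      by (simp only: of_nat_mult real_sqrt_mult mult.assoc) simp
    also have "\<dots> = (sqrt (real (k + 1)) * sqrt (real (k + 1))) * (?T * sqz s k)"
      unfolding sqz_Suc by simp
    finally show ?thesis
      by (simp add: sqz_def n)
  qed
  have down: "sqrt (real (k * (k - 1))) * sqz s (k - 2) = ?C * (real k * ?T ^ (n - 1))"
  proof (cases n)
    case 0
    then show ?thesis by (simp add: n)
  next
    case (Suc i)
    have "sqrt (real (k * (k - 1))) * sqz s (k - 2)
        = sqrt (real (2 * i + 2)) * (sqrt (real (2 * i + 1)) * sqz_wt i) * ?T ^ i / sqrt (cosh s)"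
    proof -
      have "k * (k - 1) = (2 * i + 2) * (2 * i + 1)" "sqz s (k - 2) = sqz_wt i * ?T ^ i / sqrt (cosh s)"
        by (simp_all add: n Suc sqz_def)
      then show ?thesis
        by (simp only: of_nat_mult real_sqrt_mult mult.assoc times_divide_eq_right)
    qed
    also have "\<dots> = (sqrt (real (2 * i + 2)) * sqrt (real (2 * i + 2))) * sqz_wt (Suc i) * ?T ^ i / sqrt (cosh s)"
      by (simp only: sqz_wt_Suc[symmetric] mult.assoc)
    finally show ?thesis by (simp add: n Suc del: sqz_wt.simps)
  qed
  \<comment> \<open>The coefficients match because 1/2 + n = (k + 1)/2; n = 0 is split off because
    of the truncated exponent n - 1.\<close>
  have "?C * (?T ^ Suc n / 2 - real n * ?T ^ (n - 1) * (1 - (tanh s)\<^sup>2))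
      = (?C * (real (k + 1) * ?T ^ Suc n) - ?C * (real k * ?T ^ (n - 1))) / 2"
    by (cases n) (simp_all add: n power2_eq_square algebra_simps add_divide_distrib diff_divide_distrib)
  moreover have "(\<lambda>s. sqz s k) = (\<lambda>s. sqz_wt n * (- tanh s) ^ n / sqrt (cosh s))"
    by (simp add: sqz_def n fun_eq_iff)
  ultimately show ?thesis
    unfolding up down using D by (simp only:)
qed (simp add: sqz_def)

section \<open>Product states\<close>

lemma prod_nat_family:
  fixes f :: "'n::finite \<Rightarrow> nat \<Rightarrow> real"
  assumes "\<And>j. (\<lambda>k. \<bar>f j k\<bar>) summable_on UNIV"
  shows abs_summable_prod_family: "(\<lambda>m. \<bar>\<Prod>j\<in>UNIV. f j (m j)\<bar>) summable_on UNIV"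
    and infsum_prod_family: "(\<Sum>\<^sub>\<infinity>m. \<Prod>j\<in>UNIV. f j (m j)) = (\<Prod>j\<in>UNIV. \<Sum>\<^sub>\<infinity>k. f j k)"
proof -
  have U: "PiE (UNIV::'n set) (\<lambda>_. UNIV::nat set) = UNIV"
    by auto
  show "(\<Sum>\<^sub>\<infinity>m. \<Prod>j\<in>UNIV. f j (m j)) = (\<Prod>j\<in>UNIV. \<Sum>\<^sub>\<infinity>k. f j k)"
    using infsum_prod_PiE_abs[of "UNIV::'n set" f "\<lambda>_. UNIV"] assms by (simp add: U)
  show "(\<lambda>m. \<bar>\<Prod>j\<in>UNIV. f j (m j)\<bar>) summable_on UNIV"
    using abs_summable_on_prod_PiE[of "UNIV::'n set" "\<lambda>_. UNIV" f] assms
    by (simp add: U flip: abs_summable_equivalent)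
qed

definition sqz_prod :: "('n::finite \<Rightarrow> real) \<Rightarrow> 'n state" where
  "sqz_prod q m = of_real (\<Prod>j\<in>UNIV. sqz (q j) (m j))"

lemma sqz_prod_0: "sqz_prod (\<lambda>_. 0) = vacuum"
proof
  fix m :: "'n::finite \<Rightarrow> nat"
  show "sqz_prod (\<lambda>_. 0) m = vacuum m"
  proof (cases "m = (\<lambda>_. 0)")
    case False
    then obtain j where "m j \<noteq> 0" by auto
    then have "(\<Prod>j\<in>UNIV. sqz 0 (m j)) = 0"
      by (intro prod_zero) (auto simp: sqz_0)
    with False show ?thesis
      by (simp add: sqz_prod_def vacuum_def)
  qed (simp add: sqz_prod_def vacuum_def sqz_0)
qed

lemma sqz_prod_inner:
  fixes p q :: "'n::finite \<Rightarrow> real"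
  shows "(\<lambda>m. cnj (sqz_prod p m) * sqz_prod q m) summable_on UNIV"
    and "braket (sqz_prod p) (sqz_prod q) = of_real (\<Prod>j\<in>UNIV. 1 / sqrt (cosh (p j - q j)))"
proof -
  let ?f = "\<lambda>m. \<Prod>j\<in>UNIV. sqz (p j) (m j) * sqz (q j) (m j)"
  have eq: "cnj (sqz_prod p m) * sqz_prod q m = of_real (?f m)" for m
    by (simp add: sqz_prod_def prod.distrib)
  have s: "?f summable_on UNIV"
    using abs_summable_prod_family[of "\<lambda>j k. sqz (p j) k * sqz (q j) k", OF sqz_inner(1)]
      summable_on_iff_abs_summable_on_real[of ?f UNIV] by simp
  then show "(\<lambda>m. cnj (sqz_prod p m) * sqz_prod q m) summable_on UNIV"
    unfolding eq by (rule summable_on_of_real)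
  show "braket (sqz_prod p) (sqz_prod q) = of_real (\<Prod>j\<in>UNIV. 1 / sqrt (cosh (p j - q j)))"
  proof -
    have "((\<lambda>m. complex_of_real (?f m)) has_sum of_real (\<Prod>j\<in>UNIV. 1 / sqrt (cosh (p j - q j)))) UNIV"
      using has_sum_of_real[OF has_sum_infsum[OF s]]
        infsum_prod_family[of "\<lambda>j k. sqz (p j) k * sqz (q j) k", OF sqz_inner(1)]
      by (simp only: sqz_inner(2))
    then show ?thesis
      unfolding braket_def eq by (rule infsumI)
  qed
qed

lemma sqz_prod_in_fock: "sqz_prod q \<in> fock"
proof -
  have "(\<lambda>m. complex_of_real ((cmod (sqz_prod q m))\<^sup>2)) summable_on UNIV"
    using sqz_prod_inner(1)[of q q] by (simp add: complex_norm_square mult.commute flip: of_real_power)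
  then show ?thesis
    unfolding fock_def using summable_on_Re by fastforce
qed

text \<open>The states are normalised with real overlaps, so the squared distance is 2 minus twice
  the overlap.\<close>

lemma sqz_prod_dist:
  fixes p q :: "'n::finite \<Rightarrow> real"
  shows "fock_norm (\<lambda>m. sqz_prod p m - sqz_prod q m)
    = sqrt (2 - 2 * (\<Prod>j\<in>UNIV. 1 / sqrt (cosh (p j - q j))))"
proof -
  let ?R = "\<lambda>p q m. Re (cnj (sqz_prod p m) * sqz_prod q m)"
  have s: "?R p q summable_on UNIV" for p q :: "'n \<Rightarrow> real"
    using sqz_prod_inner(1) by (rule summable_on_Re)
  have v: "(\<Sum>\<^sub>\<infinity>m. ?R p q m) = (\<Prod>j\<in>UNIV. 1 / sqrt (cosh (p j - q j)))" for p q :: "'n \<Rightarrow> real"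
    using arg_cong[OF sqz_prod_inner(2)[of p q], of Re] infsum_Re[OF sqz_prod_inner(1)[of p q]]
    by (simp only: braket_def Re_complex_of_real)
  have "(cmod (sqz_prod p m - sqz_prod q m))\<^sup>2 = ?R p p m + ?R q q m + (-2) * ?R p q m" for m
    unfolding cmod_power2 by (simp add: power2_eq_square algebra_simps)
  then have "(\<Sum>\<^sub>\<infinity>m. (cmod (sqz_prod p m - sqz_prod q m))\<^sup>2)
      = (\<Sum>\<^sub>\<infinity>m. ?R p p m) + (\<Sum>\<^sub>\<infinity>m. ?R q q m) + (-2) * (\<Sum>\<^sub>\<infinity>m. ?R p q m)"
    by (simp only: infsum_add infsum_cmult_right' summable_on_add summable_on_cmult_right s)
  then show ?thesis
    unfolding fock_norm_def v by simp
qed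

lemma ann_sqz_prod:
  fixes q :: "'n::finite \<Rightarrow> real"
  shows "ann j (sqz_prod q) = (\<lambda>m. - of_real (tanh (q j)) * cre j (sqz_prod q) m)"
proof
  fix m :: "'n \<Rightarrow> nat"
  have upd: "(\<Prod>i\<in>UNIV. sqz (q i) ((m(j := k)) i)) = sqz (q j) k * (\<Prod>i\<in>UNIV - {j}. sqz (q i) (m i))" for k
    by (subst prod.remove[of _ j]) auto
  show "ann j (sqz_prod q) m = - of_real (tanh (q j)) * cre j (sqz_prod q) m"
    unfolding ann_def cre_def sqz_prod_def upd
    using sqz_Suc[of "m j" "q j"]
    by (simp flip: of_real_mult of_real_minus mult.assoc del: of_nat_Suc of_nat_add)
qed

lemma squeeze_gen_apply:
  "squeeze_gen r j \<psi> m = of_real (r $ j / 2) *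
    (of_real (sqrt (real ((m j + 1) * (m j + 2)))) * \<psi> (m(j := m j + 2))
     - of_real (sqrt (real (m j * (m j - 1)))) * \<psi> (m(j := m j - 2)))"
proof -
  have "sqrt (real ((m j + 1) * (m j + 2))) = sqrt (real (m j + 1)) * sqrt (real (m j + 1 + 1))"
    "sqrt (real (m j * (m j - 1))) = sqrt (real (m j)) * sqrt (real (m j - 1))"
    unfolding of_nat_mult real_sqrt_mult by simp_all
  then show ?thesis
    by (simp add: squeeze_gen_def ann_def cre_def mult.assoc numeral_2_eq_2)
qed

text \<open>The assumption puts mode j in its vacuum at time 0; its squeezing parameter then grows
  linearly in time while the other factors stay constant.\<close>

lemma sqz_prod_is_flow:
  fixes q :: "'n::finite \<Rightarrow> real"
  assumes "q j = 0"
  shows "is_flow (squeeze_gen r j) (sqz_prod q) (\<lambda>t. sqz_prod (q(j := t * r $ j)))"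
  unfolding is_flow_def
proof (intro conjI allI)
  let ?u = "\<lambda>t. sqz_prod (q(j := t * r $ j))"
  show "?u 0 = sqz_prod q"
    using assms by (simp add: fun_upd_idem)
  show "?u t \<in> fock" for t
    by (rule sqz_prod_in_fock)
  show "((\<lambda>s. fock_norm (\<lambda>m. ?u s m - ?u t m)) \<longlongrightarrow> 0) (at t)" for t
  proof -
    have "fock_norm (\<lambda>m. ?u s m - ?u t m) = sqrt (2 - 2 * (1 / sqrt (cosh (s * r $ j - t * r $ j))))" for s
      unfolding sqz_prod_dist by (subst prod.remove[of _ j]) auto
    moreover have "((\<lambda>s. sqrt (2 - 2 * (1 / sqrt (cosh (s * r $ j - t * r $ j))))) \<longlongrightarrow>
        sqrt (2 - 2 * (1 / sqrt (cosh (t * r $ j - t * r $ j))))) (at t)"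
      by (intro tendsto_intros) auto
    ultimately show ?thesis by simp
  qed
  show "((\<lambda>s. ?u s m) has_vector_derivative squeeze_gen r j (?u t) m) (at t)" for t m
  proof -
    let ?R = "\<Prod>i\<in>UNIV - {j}. sqz (q i) (m i)"
    have upd: "sqz_prod (q(j := s)) (m(j := k)) = of_real (sqz s k * ?R)" for s k
      unfolding sqz_prod_def by (subst prod.remove[of _ j]) auto
    have upd': "sqz_prod (q(j := s)) m = of_real (sqz s (m j) * ?R)" for s
      using upd[of s "m j"] by simp
    have eq: "complex_of_real ((A * x - B * y) / 2 * z * R)
        = of_real (z / 2) * (of_real A * of_real (x * R) - of_real B * of_real (y * R))" for A B x y z R
      by (simp add: field_simps)
    have "((\<lambda>s. sqz (s * r $ j) (m j) * ?R) has_real_derivative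
       ((sqrt (real ((m j + 1) * (m j + 2))) * sqz (t * r $ j) (m j + 2)
        - sqrt (real (m j * (m j - 1))) * sqz (t * r $ j) (m j - 2)) / 2 * r $ j) * ?R) (at t)"
      by (intro DERIV_cmult_right DERIV_chain2[OF sqz_has_derivative]) (auto intro!: derivative_eq_intros)
    then have "((\<lambda>s. complex_of_real (sqz (s * r $ j) (m j) * ?R)) has_vector_derivative of_real
       (((sqrt (real ((m j + 1) * (m j + 2))) * sqz (t * r $ j) (m j + 2)
        - sqrt (real (m j * (m j - 1))) * sqz (t * r $ j) (m j - 2)) / 2 * r $ j) * ?R)) (at t)"
      by (intro has_vector_derivative_of_real) (simp add: has_real_derivative_iff_has_vector_derivative)
    then show ?thesis
      unfolding upd' squeeze_gen_apply upd eq .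
  qed
qed

section \<open>Uniqueness of the squeezing flow\<close>

text \<open>Index shift for a summation by parts; the four conditions remove the boundary terms at
  both ends.\<close>

lemma sum_lessThan_shift2:
  fixes g :: "nat \<Rightarrow> 'a::ab_group_add"
  assumes "g 0 = 0" "g 1 = 0" "g K = 0" "g (K + 1) = 0"
  shows "(\<Sum>k<K. g k) = (\<Sum>k<K. g (k + 2))"
proof -
  have "(\<Sum>k<Suc (Suc K). g k) = (\<Sum>k<K. g (k + 2))"
    unfolding sum.lessThan_Suc_shift using assms by simp
  with assms show ?thesis by simp
qed

text \<open>
  The cut-off \<open>\<eta>\<close> decays logarithmically, so its increments compensate the linear growth of the
  matrix elements of the generator: the truncated norm changes at a rate \<open>O(M / L)\<close>, uniformly in
  the truncation.
\<close>
lemma squeeze_ode_unique: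
  fixes w :: "real \<Rightarrow> nat \<Rightarrow> complex" and \<beta> M :: real
  assumes w0: "\<And>k. w 0 k = 0"
    and deriv: "\<And>t k. 0 \<le> t \<Longrightarrow> t \<le> 1 \<Longrightarrow> ((\<lambda>s. w s k) has_vector_derivative
        of_real \<beta> * (of_real (sqrt (real ((k + 1) * (k + 2)))) * w t (k + 2)
          - of_real (sqrt (real (k * (k - 1)))) * w t (k - 2))) (at t)"
    and bdd: "\<And>t K. 0 \<le> t \<Longrightarrow> t \<le> 1 \<Longrightarrow> (\<Sum>k<K. (cmod (w t k))\<^sup>2) \<le> M"
  shows "w 1 k = 0"
proof -
  define d where "d k = sqrt (real ((k + 1) * (k + 2)))" for k
  define e where "e k = sqrt (real (k * (k - 1)))" for k
  \<comment> \<open>Levels k and k + 2 are coupled with equal strength in both directions; with the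
    opposite signs in the equation this is skew-symmetry.\<close>
  have e_d: "e (k + 2) = d k" "e 0 = 0" "e 1 = 0" for k
    by (simp_all add: e_def d_def mult.commute)
  have d_le: "0 \<le> d k" "d k \<le> 2 * real (k + 1)" for k
  proof -
    have "d k \<le> sqrt ((2 * real (k + 1))\<^sup>2)"
      unfolding d_def by (intro real_sqrt_le_mono) (simp add: power2_eq_square algebra_simps)
    then show "d k \<le> 2 * real (k + 1)" by simp
  qed (simp add: d_def)
  have M: "0 \<le> M"
    using bdd[of 0 0] by simp
  \<comment> \<open>L is the width of the cut-off on the harmonic scale and finally tends to
    infinity. The condition \<open>2 * harm k \<le> L\<close> gives level k weight at least 1/2,
    which turns the constant 8 below into 16.\<close>
  have key: "(cmod (w 1 k))\<^sup>2 \<le> 16 * \<bar>\<beta>\<bar> * M / L" if L: "0 < L" "2 * harm k \<le> L" for L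
  proof -
    \<comment> \<open>Harmonic increments of order 1/k balance matrix elements of order k, yet their
      sum diverges, so the cut-off has finite support.\<close>
    define \<eta> where "\<eta> k = max 0 (1 - harm k / L)" for k
    have "eventually (\<lambda>n. L \<le> (harm n :: real)) sequentially"
      using harm_at_top unfolding filterlim_at_top by blast
    then obtain K0 where K0: "\<And>n. n \<ge> K0 \<Longrightarrow> L \<le> harm n"
      unfolding eventually_sequentially by blast
    define K where "K = max K0 (Suc k)"
    have K: "k < K" "\<And>n. n \<ge> K \<Longrightarrow> \<eta> n = 0"
      using K0 L by (auto simp: K_def \<eta>_def)
    have \<eta>_diff: "0 \<le> \<eta> i - \<eta> (i + 2)" "d i * (\<eta> i - \<eta> (i + 2)) \<le> 4 / L" for i
    proof -
      have "harm (i + 2) = harm i + (1 / real (i + 1) + 1 / real (i + 2))"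
        by (simp add: harm_Suc inverse_eq_divide)
      moreover have "1 / real (i + 2) \<le> 1 / real (i + 1)"
        by (intro divide_left_mono) auto
      ultimately have h: "harm i \<le> (harm (i + 2) :: real)" "harm (i + 2) - harm i \<le> 2 / real (i + 1)"
        by auto
      show 0: "0 \<le> \<eta> i - \<eta> (i + 2)"
        using divide_right_mono[OF h(1), of L] L unfolding \<eta>_def by linarith
      have "\<eta> i - \<eta> (i + 2) \<le> (harm (i + 2) - harm i) / L"
        using divide_right_mono[OF h(1), of L] L unfolding \<eta>_def diff_divide_distrib by linarith
      also have "\<dots> \<le> 2 / real (i + 1) / L"
        using h L by (intro divide_right_mono) auto
      finally have "d i * (\<eta> i - \<eta> (i + 2)) \<le> 2 * real (i + 1) * (2 / real (i + 1) / L)"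
        using 0 d_le[of i] by (intro mult_mono) auto
      then show "d i * (\<eta> i - \<eta> (i + 2)) \<le> 4 / L"
        by (simp del: of_nat_add of_nat_Suc)
    qed
    define N where "N t = (\<Sum>i<K. \<eta> i * (w t i \<bullet> w t i))" for t
    \<comment> \<open>The derivative of \<open>N\<close> after summation by parts: the two couplings
      cancel up to the increments of the cut-off.\<close>
    define N' where "N' t = (\<Sum>i<K. 2 * \<beta> * (d i * (\<eta> i - \<eta> (i + 2)) * (w t i \<bullet> w t (i + 2))))" for t
    have DN: "(N has_real_derivative N' t) (at t)" if t: "0 \<le> t" "t \<le> 1" for t
    proof -
      let ?w' = "\<lambda>i. \<beta> *\<^sub>R (d i *\<^sub>R w t (i + 2) - e i *\<^sub>R w t (i - 2))"
      have "((\<lambda>s. w s i) has_vector_derivative ?w' i) (at t)" for i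
        using deriv[OF t, of i] by (simp add: scaleR_conv_of_real d_def e_def)
      from bounded_bilinear.has_vector_derivative[OF bounded_bilinear_inner this this]
      have "((\<lambda>s. w s i \<bullet> w s i) has_real_derivative (w t i \<bullet> ?w' i + ?w' i \<bullet> w t i)) (at t)" for i
        by (simp add: has_real_derivative_iff_has_vector_derivative)
      then have "(N has_real_derivative (\<Sum>i<K. \<eta> i * (w t i \<bullet> ?w' i + ?w' i \<bullet> w t i))) (at t)"
        unfolding N_def[abs_def] by (intro DERIV_sum DERIV_cmult)
      also have "(\<Sum>i<K. \<eta> i * (w t i \<bullet> ?w' i + ?w' i \<bullet> w t i))
        = 2 * \<beta> * ((\<Sum>i<K. \<eta> i * d i * (w t i \<bullet> w t (i + 2))) - (\<Sum>i<K. \<eta> i * e i * (w t i \<bullet> w t (i - 2))))"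
        unfolding sum_distrib_left sum_subtractf[symmetric]
        by (intro sum.cong refl) (simp add: inner_commute inner_diff_right algebra_simps)
      \<comment> \<open>The boundary terms vanish at 0 and 1 through \<open>e\<close>, at K and K +
        1 through the cut-off.\<close>
      also have "(\<Sum>i<K. \<eta> i * e i * (w t i \<bullet> w t (i - 2)))
        = (\<Sum>i<K. \<eta> (i + 2) * d i * (w t (i + 2) \<bullet> w t i))"
        by (subst sum_lessThan_shift2) (simp_all only: e_d K(2), simp_all add: K(2))
      also have "2 * \<beta> * ((\<Sum>i<K. \<eta> i * d i * (w t i \<bullet> w t (i + 2))) - \<dots>) = N' t"
        unfolding N'_def sum_distrib_left sum_subtractf[symmetric]
        by (intro sum.cong refl) (simp add: inner_commute algebra_simps)
      finally show ?thesis .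
    qed
    have N'_bound: "\<bar>N' t\<bar> \<le> 8 * \<bar>\<beta>\<bar> * M / L" if t: "0 \<le> t" "t \<le> 1" for t
    proof -
      have "\<bar>N' t\<bar> \<le> (\<Sum>i<K. 2 * \<bar>\<beta>\<bar> * (4 / L * (((cmod (w t i))\<^sup>2 + (cmod (w t (i + 2)))\<^sup>2) / 2)))"
        unfolding N'_def
      proof (rule order_trans[OF sum_abs], rule sum_mono)
        fix i
        have "\<bar>w t i \<bullet> w t (i + 2)\<bar> \<le> cmod (w t i) * cmod (w t (i + 2))"
          by (rule Cauchy_Schwarz_ineq2)
        also have "\<dots> \<le> ((cmod (w t i))\<^sup>2 + (cmod (w t (i + 2)))\<^sup>2) / 2"
          using sum_squares_bound[of "cmod (w t i)" "cmod (w t (i + 2))"] by simp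
        finally have "d i * (\<eta> i - \<eta> (i + 2)) * \<bar>w t i \<bullet> w t (i + 2)\<bar>
            \<le> 4 / L * (((cmod (w t i))\<^sup>2 + (cmod (w t (i + 2)))\<^sup>2) / 2)"
          using \<eta>_diff[of i] L by (intro mult_mono) auto
        then have "2 * \<bar>\<beta>\<bar> * (d i * (\<eta> i - \<eta> (i + 2)) * \<bar>w t i \<bullet> w t (i + 2)\<bar>)
            \<le> 2 * \<bar>\<beta>\<bar> * (4 / L * (((cmod (w t i))\<^sup>2 + (cmod (w t (i + 2)))\<^sup>2) / 2))"
          by (rule mult_left_mono) simp
        then show "\<bar>2 * \<beta> * (d i * (\<eta> i - \<eta> (i + 2)) * (w t i \<bullet> w t (i + 2)))\<bar>
            \<le> 2 * \<bar>\<beta>\<bar> * (4 / L * (((cmod (w t i))\<^sup>2 + (cmod (w t (i + 2)))\<^sup>2) / 2))"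
          using \<eta>_diff(1)[of i] d_le(1)[of i] by (simp only: abs_mult abs_of_nonneg abs_numeral)
      qed
      also have "\<dots> = 4 * \<bar>\<beta>\<bar> / L * ((\<Sum>i<K. (cmod (w t i))\<^sup>2) + (\<Sum>i<K. (cmod (w t (i + 2)))\<^sup>2))"
        unfolding sum_distrib_left sum.distrib[symmetric]
        using L by (intro sum.cong refl) (simp add: field_simps)
      also have "\<dots> \<le> 4 * \<bar>\<beta>\<bar> / L * (M + M)"
      proof (intro mult_left_mono add_mono)
        have "(\<Sum>i<K. (cmod (w t (i + 2)))\<^sup>2) \<le> (\<Sum>i<Suc (Suc K). (cmod (w t i))\<^sup>2)"
          unfolding sum.lessThan_Suc_shift by simp
        also have "\<dots> \<le> M"
          using bdd t by blast
        finally show "(\<Sum>i<K. (cmod (w t (i + 2)))\<^sup>2) \<le> M" .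
      qed (use bdd t L in auto)
      finally show ?thesis by simp
    qed
    obtain z where z: "0 < z" "z < 1" "N 1 - N 0 = (1 - 0) * N' z"
      using MVT2[of 0 1 N N'] DN by auto
    have "\<eta> k * (w 1 k \<bullet> w 1 k) \<le> N 1"
      unfolding N_def by (rule member_le_sum) (use K in \<open>auto simp: \<eta>_def\<close>)
    also have "N 1 = N' z"
      using z w0 by (simp add: N_def)
    also have "\<dots> \<le> 8 * \<bar>\<beta>\<bar> * M / L"
      using N'_bound[of z] z by simp
    finally have "\<eta> k * (cmod (w 1 k))\<^sup>2 \<le> 8 * \<bar>\<beta>\<bar> * M / L"
      by (simp add: power2_norm_eq_inner)
    moreover have "1 / 2 * (cmod (w 1 k))\<^sup>2 \<le> \<eta> k * (cmod (w 1 k))\<^sup>2"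
      using L by (intro mult_right_mono) (auto simp: \<eta>_def field_simps)
    ultimately show ?thesis by simp
  qed
  have "((\<lambda>L. 16 * \<bar>\<beta>\<bar> * M / L) \<longlongrightarrow> 0) at_top"
    by (rule tendsto_divide_0[OF tendsto_const filterlim_mono[OF filterlim_ident at_top_le_at_infinity order.refl]])
  moreover have "\<forall>\<^sub>F L in at_top. (cmod (w 1 k))\<^sup>2 \<le> 16 * \<bar>\<beta>\<bar> * M / L"
    using eventually_gt_at_top[of 0] eventually_ge_at_top[of "2 * harm k"]
    by eventually_elim (rule key)
  ultimately have "(cmod (w 1 k))\<^sup>2 \<le> 0"
    by (intro tendsto_lowerbound) auto
  then show ?thesis by simp
qed

section \<open>From uniqueness for one mode to the canonical probe\<close>

lemma cmod_diff_square_le: "(cmod (x - y))\<^sup>2 \<le> 2 * (cmod x)\<^sup>2 + 2 * (cmod y)\<^sup>2"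
proof -
  have "(cmod (x - y))\<^sup>2 \<le> (cmod x + cmod y)\<^sup>2"
    by (intro power_mono norm_triangle_ineq4) auto
  also have "\<dots> \<le> 2 * (cmod x)\<^sup>2 + 2 * (cmod y)\<^sup>2"
    using sum_squares_bound[of "cmod x" "cmod y"] by (simp add: power2_sum)
  finally show ?thesis .
qed

lemma fock_diff:
  assumes "\<phi> \<in> fock" "\<psi> \<in> fock"
  shows "(\<lambda>m. \<phi> m - \<psi> m) \<in> fock"
proof -
  have "(\<lambda>m. 2 * (cmod (\<phi> m))\<^sup>2 + 2 * (cmod (\<psi> m))\<^sup>2) summable_on UNIV"
    using assms unfolding fock_def by (intro summable_on_add summable_on_cmult_right) auto
  then show ?thesis
    unfolding fock_def mem_Collect_eq
    by (rule summable_on_comparison_test) (auto intro: cmod_diff_square_le)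
qed

lemma sum_le_fock_norm:
  assumes "\<psi> \<in> fock" "finite F"
  shows "(\<Sum>m\<in>F. (cmod (\<psi> m))\<^sup>2) \<le> (fock_norm \<psi>)\<^sup>2"
proof -
  have "(fock_norm \<psi>)\<^sup>2 = (\<Sum>\<^sub>\<infinity>m. (cmod (\<psi> m))\<^sup>2)"
    unfolding fock_norm_def by (simp add: infsum_nonneg)
  with assms show ?thesis
    by (auto simp: fock_def intro!: finite_sum_le_infsum)
qed

text \<open>Norm continuity gives local bounds, and compactness of the time interval, in the form of
  bisection, makes them uniform.\<close>

lemma flow_bounded:
  assumes "is_flow A \<psi> u"
  shows "\<exists>M. \<forall>t\<in>{0..1}. \<forall>F. finite F \<longrightarrow> (\<Sum>m\<in>F. (cmod (u t m))\<^sup>2) \<le> M"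
proof -
  have fock: "u t \<in> fock" for t
    using assms by (auto simp: is_flow_def)
  have cont: "((\<lambda>s. fock_norm (\<lambda>m. u s m - u t m)) \<longlongrightarrow> 0) (at t)" for t
    using assms by (auto simp: is_flow_def)
  define P where "P a b \<longleftrightarrow> (\<exists>M. \<forall>t\<in>{a..b}. \<forall>F. finite F \<longrightarrow> (\<Sum>m\<in>F. (cmod (u t m))\<^sup>2) \<le> M)" for a b
  have "P 0 1"
  proof (rule Bolzano)
    show "P a c" if P: "P a b" "P b c" for a b c
    proof -
      obtain M N where "\<And>t F. t \<in> {a..b} \<Longrightarrow> finite F \<Longrightarrow> (\<Sum>m\<in>F. (cmod (u t m))\<^sup>2) \<le> M"
        "\<And>t F. t \<in> {b..c} \<Longrightarrow> finite F \<Longrightarrow> (\<Sum>m\<in>F. (cmod (u t m))\<^sup>2) \<le> N"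
        using P unfolding P_def by metis
      moreover have "t \<in> {a..b} \<or> t \<in> {b..c}" if "t \<in> {a..c}" for t
        using that by auto
      ultimately have "(\<Sum>m\<in>F. (cmod (u t m))\<^sup>2) \<le> max M N" if "t \<in> {a..c}" "finite F" for t F
        using that by (metis max.coboundedI1 max.coboundedI2)
      then show ?thesis unfolding P_def by blast
    qed
    show "\<exists>d>0. \<forall>a b. a \<le> x \<and> x \<le> b \<and> b - a < d \<longrightarrow> P a b" for x
    proof -
      have "\<forall>\<^sub>F s in at x. fock_norm (\<lambda>m. u s m - u x m) < 1"
        using cont[of x] by (rule order_tendstoD) simp
      then obtain d where d: "d > 0" "\<And>s. s \<noteq> x \<Longrightarrow> dist s x < d \<Longrightarrow> fock_norm (\<lambda>m. u s m - u x m) < 1"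
        unfolding eventually_at by auto
      have "(\<Sum>m\<in>F. (cmod (u s m))\<^sup>2) \<le> 2 + 2 * (fock_norm (u x))\<^sup>2" if s: "dist s x < d" and F: "finite F" for s F
      proof -
        \<comment> \<open>The filter \<open>at x\<close> excludes s = x, where the difference is
          zero.\<close>
        have "fock_norm (\<lambda>m. u s m - u x m) \<le> 1"
          using d(2)[of s] s by (cases "s = x") (auto simp: fock_norm_def)
        moreover have "0 \<le> fock_norm (\<lambda>m. u s m - u x m)"
          by (simp add: fock_norm_def infsum_nonneg)
        ultimately have 1: "(fock_norm (\<lambda>m. u s m - u x m))\<^sup>2 \<le> 1"
          by (simp add: power_le_one)
        have "(\<Sum>m\<in>F. (cmod (u s m))\<^sup>2) \<le> (\<Sum>m\<in>F. 2 * (cmod (u s m - u x m))\<^sup>2 + 2 * (cmod (u x m))\<^sup>2)"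
        proof (rule sum_mono)
          fix m
          show "(cmod (u s m))\<^sup>2 \<le> 2 * (cmod (u s m - u x m))\<^sup>2 + 2 * (cmod (u x m))\<^sup>2"
            using cmod_diff_square_le[of "u s m - u x m" "- u x m"] by simp
        qed
        also have "\<dots> = 2 * (\<Sum>m\<in>F. (cmod (u s m - u x m))\<^sup>2) + 2 * (\<Sum>m\<in>F. (cmod (u x m))\<^sup>2)"
          by (simp add: sum.distrib sum_distrib_left)
        also have "\<dots> \<le> 2 + 2 * (fock_norm (u x))\<^sup>2"
          using sum_le_fock_norm[OF fock_diff[OF fock[of s] fock[of x]] F] sum_le_fock_norm[OF fock[of x] F] 1
          by simp
        finally show ?thesis .
      qed
      moreover have "dist s x < d" if "a \<le> x" "x \<le> b" "b - a < d" "s \<in> {a..b}" for a b s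
        using that by (auto simp: dist_real_def)
      ultimately show ?thesis
        using d(1) unfolding P_def by blast
    qed
  qed simp
  then show ?thesis unfolding P_def .
qed

lemma squeeze_flow_unique:
  assumes u: "is_flow (squeeze_gen r j) \<psi> u" and v: "is_flow (squeeze_gen r j) \<psi> v"
  shows "u 1 = v 1"
proof
  fix m
  obtain M where M: "\<And>t F. 0 \<le> t \<Longrightarrow> t \<le> 1 \<Longrightarrow> finite F \<Longrightarrow> (\<Sum>m\<in>F. (cmod (u t m))\<^sup>2) \<le> M"
    using flow_bounded[OF u] by (metis atLeastAtMost_iff)
  obtain N where N: "\<And>t F. 0 \<le> t \<Longrightarrow> t \<le> 1 \<Longrightarrow> finite F \<Longrightarrow> (\<Sum>m\<in>F. (cmod (v t m))\<^sup>2) \<le> N"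
    using flow_bounded[OF v] by (metis atLeastAtMost_iff)
  \<comment> \<open>The generator changes only the occupation of mode j, so the difference
    restricted to this line of occupations obeys a closed one-mode system.\<close>
  define w where "w t k = u t (m(j := k)) - v t (m(j := k))" for t k
  have "w 1 (m j) = 0"
  proof (rule squeeze_ode_unique)
    show "w 0 k = 0" for k
      using u v by (simp add: w_def is_flow_def)
    show "((\<lambda>s. w s k) has_vector_derivative
        of_real (r $ j / 2) * (of_real (sqrt (real ((k + 1) * (k + 2)))) * w t (k + 2)
          - of_real (sqrt (real (k * (k - 1)))) * w t (k - 2))) (at t)" for t k
    proof -
      have "((\<lambda>s. w s k) has_vector_derivative
          squeeze_gen r j (u t) (m(j := k)) - squeeze_gen r j (v t) (m(j := k))) (at t)"
        unfolding w_def using u v by (intro has_vector_derivative_diff) (simp_all add: is_flow_def)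
      then show ?thesis
        unfolding squeeze_gen_apply w_def by (rule back_subst) (simp add: right_diff_distrib)
    qed
    show "(\<Sum>k<K. (cmod (w t k))\<^sup>2) \<le> 2 * M + 2 * N" if t: "0 \<le> t" "t \<le> 1" for t K
    proof -
      have inj: "inj_on (\<lambda>k. m(j := k)) {..<K}"
        by (auto intro!: inj_onI dest: fun_cong[of _ _ j])
      have "(\<Sum>k<K. (cmod (w t k))\<^sup>2)
          \<le> (\<Sum>k<K. 2 * (cmod (u t (m(j := k))))\<^sup>2 + 2 * (cmod (v t (m(j := k))))\<^sup>2)"
        unfolding w_def by (intro sum_mono cmod_diff_square_le)
      also have "\<dots> = 2 * (\<Sum>m\<in>(\<lambda>k. m(j := k)) ` {..<K}. (cmod (u t m))\<^sup>2)
          + 2 * (\<Sum>m\<in>(\<lambda>k. m(j := k)) ` {..<K}. (cmod (v t m))\<^sup>2)"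
        by (simp add: sum.reindex[OF inj] sum.distrib sum_distrib_left)
      also have "\<dots> \<le> 2 * M + 2 * N"
        using M N t by (intro add_mono mult_left_mono) auto
      finally show ?thesis .
    qed
  qed
  then show "u 1 m = v 1 m" by (simp add: w_def)
qed

lemma exp_squeeze_gen_sqz_prod:
  fixes q :: "'n::finite \<Rightarrow> real"
  assumes "q j = 0"
  shows "exp_op (squeeze_gen r j) (sqz_prod q) = sqz_prod (q(j := r $ j))"
proof -
  have "\<exists>u. is_flow (squeeze_gen r j) (sqz_prod q) u \<and> u 1 = sqz_prod (q(j := r $ j))"
    using sqz_prod_is_flow[of q j r, OF assms] by (intro exI conjI, assumption) simp
  then show ?thesis
    unfolding exp_op_def by (intro the_equality) (assumption, metis squeeze_flow_unique)
qed

text \<open>Induction over the squeezed modes; distinctness ensures that each mode is still in its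
  vacuum when its turn comes.\<close>

lemma probe_eq_sqz_prod:
  fixes r :: "real ^ 'n::{finite,linorder}"
  shows "probe r = sqz_prod (($) r)"
proof -
  have "foldr (\<lambda>j S. exp_op (squeeze_gen r j) \<circ> S) js id vacuum
      = sqz_prod (\<lambda>j. if j \<in> set js then r $ j else 0)" if "distinct js" for js
    using that
  proof (induction js)
    case Nil
    then show ?case by (simp add: sqz_prod_0)
  next
    case (Cons i js)
    have "(\<lambda>j. if j \<in> set (i # js) then r $ j else 0) = (\<lambda>j. if j \<in> set js then r $ j else 0)(i := r $ i)"
      by auto
    with Cons show ?case
      by (simp add: exp_squeeze_gen_sqz_prod)
  qed
  from this[of "sorted_list_of_set UNIV"] show ?thesis
    by (simp add: probe_def squeeze_def)
qed

section \<open>Rapidly decaying states\<close>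

text \<open>A domain that contains the probe, is invariant under all ladder operators and makes
  inner products converge absolutely. A positive rate permits division when an index is
  lowered.\<close>

definition geom_decay :: "('n::finite) state \<Rightarrow> bool" where
  "geom_decay \<phi> \<longleftrightarrow> (\<exists>C \<sigma>. 0 < \<sigma> \<and> \<sigma> < 1 \<and> (\<forall>m. cmod (\<phi> m) \<le> C * \<sigma> ^ (\<Sum>j\<in>UNIV. m j)))"

lemma geom_decayE:
  assumes "geom_decay \<phi>"
  obtains C \<sigma> where "0 \<le> C" "0 < \<sigma>" "\<sigma> < 1" "\<And>m. cmod (\<phi> m) \<le> C * \<sigma> ^ (\<Sum>j\<in>UNIV. m j)"
proof -
  obtain C \<sigma> where *: "0 < \<sigma>" "\<sigma> < 1" "\<And>m. cmod (\<phi> m) \<le> C * \<sigma> ^ (\<Sum>j\<in>UNIV. m j)"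
    using assms unfolding geom_decay_def by blast
  have "0 \<le> C"
    using order_trans[OF norm_ge_zero *(3)[of "\<lambda>_. 0"]] by simp
  with * that show thesis by blast
qed

lemma geom_decay_add:
  assumes "geom_decay \<phi>" "geom_decay \<psi>"
  shows "geom_decay (\<lambda>m. \<phi> m + \<psi> m)"
proof -
  obtain C \<sigma> where C: "0 \<le> C" "0 < \<sigma>" "\<sigma> < 1" "\<And>m. cmod (\<phi> m) \<le> C * \<sigma> ^ (\<Sum>j\<in>UNIV. m j)"
    using geom_decayE[OF assms(1)] by metis
  obtain D \<tau> where D: "0 \<le> D" "0 < \<tau>" "\<tau> < 1" "\<And>m. cmod (\<psi> m) \<le> D * \<tau> ^ (\<Sum>j\<in>UNIV. m j)"
    using geom_decayE[OF assms(2)] by metis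
  have "cmod (\<phi> m + \<psi> m) \<le> (C + D) * max \<sigma> \<tau> ^ (\<Sum>j\<in>UNIV. m j)" for m
  proof -
    have "C * \<sigma> ^ (\<Sum>j\<in>UNIV. m j) \<le> C * max \<sigma> \<tau> ^ (\<Sum>j\<in>UNIV. m j)"
      "D * \<tau> ^ (\<Sum>j\<in>UNIV. m j) \<le> D * max \<sigma> \<tau> ^ (\<Sum>j\<in>UNIV. m j)"
      using C D by (auto intro!: mult_left_mono power_mono)
    then show ?thesis
      using norm_triangle_ineq[of "\<phi> m" "\<psi> m"] C(4)[of m] D(4)[of m] by (simp add: distrib_right)
  qed
  moreover have "0 < max \<sigma> \<tau>" "max \<sigma> \<tau> < 1"
    using C D by auto
  ultimately show ?thesis
    unfolding geom_decay_def by blast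
qed

lemma geom_decay_cmult:
  assumes "geom_decay \<phi>"
  shows "geom_decay (\<lambda>m. c * \<phi> m)"
proof -
  obtain C \<sigma> where C: "0 \<le> C" "0 < \<sigma>" "\<sigma> < 1" "\<And>m. cmod (\<phi> m) \<le> C * \<sigma> ^ (\<Sum>j\<in>UNIV. m j)"
    using geom_decayE[OF assms] by metis
  have "cmod (c * \<phi> m) \<le> (cmod c * C) * \<sigma> ^ (\<Sum>j\<in>UNIV. m j)" for m
    unfolding norm_mult mult.assoc by (intro mult_left_mono C) auto
  with C show ?thesis
    unfolding geom_decay_def by blast
qed

text \<open>Ladder factors grow at most linearly in the total occupation; moving the rate halfway
  towards 1 absorbs them.\<close>

lemma linear_times_geometric_le:
  fixes \<sigma> :: real
  assumes "0 < \<sigma>" "\<sigma> < 1"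
  obtains B \<tau> where "0 < B" "\<sigma> < \<tau>" "\<tau> < 1" "\<And>n. real n * \<sigma> ^ n \<le> B * \<tau> ^ n"
proof -
  define \<tau> where "\<tau> = (1 + \<sigma>) / 2"
  have \<tau>: "\<sigma> < \<tau>" "\<tau> < 1" "0 < \<tau>"
    using assms by (auto simp: \<tau>_def)
  then have "(\<lambda>n. real n * (\<sigma> / \<tau>) ^ n) \<longlonglongrightarrow> 0"
    using assms by (intro powser_times_n_limit_0) auto
  then have "Bseq (\<lambda>n. real n * (\<sigma> / \<tau>) ^ n)"
    by (intro convergent_imp_Bseq convergentI)
  then obtain B where B: "0 < B" "\<And>n. norm (real n * (\<sigma> / \<tau>) ^ n) \<le> B"
    by (rule BseqE) blast
  have "real n * \<sigma> ^ n \<le> B * \<tau> ^ n" for n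
  proof -
    have "real n * (\<sigma> / \<tau>) ^ n \<le> B"
      using B(2)[of n] by simp
    with \<tau> show ?thesis
      by (simp add: power_divide divide_le_eq)
  qed
  with that B \<tau> show thesis by blast
qed

lemma sum_fun_upd_nat:
  fixes m :: "'n::finite \<Rightarrow> nat"
  shows "(\<Sum>i\<in>UNIV. (m(j := k)) i) + m j = (\<Sum>i\<in>UNIV. m i) + k"
  by (subst (1 2) sum.remove[of _ j]) auto

lemma sqrt_le_self: "sqrt (real n) \<le> real n"
  by (cases n) (auto intro!: real_le_lsqrt simp: power2_eq_square)

lemma geom_decay_ann:
  fixes \<phi> :: "('n::finite) state"
  assumes "geom_decay \<phi>"
  shows "geom_decay (ann j \<phi>)"
proof -
  obtain C \<sigma> where C: "0 \<le> C" "0 < \<sigma>" "\<sigma> < 1" "\<And>m. cmod (\<phi> m) \<le> C * \<sigma> ^ (\<Sum>j\<in>UNIV. m j)"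
    using geom_decayE[OF assms] by metis
  obtain B \<tau> where B: "0 < B" "\<sigma> < \<tau>" "\<tau> < 1" "\<And>n. real n * \<sigma> ^ n \<le> B * \<tau> ^ n"
    using linear_times_geometric_le[OF C(2,3)] by metis
  have "cmod (ann j \<phi> m) \<le> (C * B) * \<tau> ^ (\<Sum>j\<in>UNIV. m j)" for m
  proof -
    let ?N = "\<Sum>j\<in>UNIV. m j"
    have "(\<Sum>i\<in>UNIV. (m(j := m j + 1)) i) = Suc ?N"
      using sum_fun_upd_nat[of m j "m j + 1"] by simp
    then have "cmod (\<phi> (m(j := m j + 1))) \<le> C * \<sigma> ^ Suc ?N"
      using C(4)[of "m(j := m j + 1)"] by simp
    moreover have "m j \<le> ?N"
      by (rule member_le_sum) auto
    then have "sqrt (real (m j + 1)) \<le> real (Suc ?N)"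
      using sqrt_le_self[of "m j + 1"] by linarith
    ultimately have "cmod (ann j \<phi> m) \<le> real (Suc ?N) * (C * \<sigma> ^ Suc ?N)"
      unfolding ann_def norm_mult by (intro mult_mono) (auto simp del: of_nat_sum)
    also have "\<dots> = C * (real (Suc ?N) * \<sigma> ^ Suc ?N)"
      by simp
    also have "\<dots> \<le> C * (B * \<tau> ^ Suc ?N)"
      by (intro mult_left_mono B(4) C(1))
    also have "\<dots> \<le> C * (B * \<tau> ^ ?N)"
      using C B by (intro mult_left_mono power_decreasing) auto
    finally show ?thesis by simp
  qed
  then show ?thesis
    using B C unfolding geom_decay_def by (meson less_trans)
qed

lemma geom_decay_cre:
  fixes \<phi> :: "('n::finite) state"
  assumes "geom_decay \<phi>"
  shows "geom_decay (cre j \<phi>)"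
proof -
  obtain C \<sigma> where C: "0 \<le> C" "0 < \<sigma>" "\<sigma> < 1" "\<And>m. cmod (\<phi> m) \<le> C * \<sigma> ^ (\<Sum>j\<in>UNIV. m j)"
    using geom_decayE[OF assms] by metis
  obtain B \<tau> where B: "0 < B" "\<sigma> < \<tau>" "\<tau> < 1" "\<And>n. real n * \<sigma> ^ n \<le> B * \<tau> ^ n"
    using linear_times_geometric_le[OF C(2,3)] by metis
  have "cmod (cre j \<phi> m) \<le> (C / \<sigma> * B) * \<tau> ^ (\<Sum>j\<in>UNIV. m j)" for m
  proof (cases "m j")
    case 0
    then show ?thesis
      using C B by (simp add: cre_def)
  next
    case (Suc k)
    let ?N = "\<Sum>j\<in>UNIV. m j"
    have "Suc (\<Sum>i\<in>UNIV. (m(j := m j - 1)) i) = ?N"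
      using sum_fun_upd_nat[of m j "m j - 1"] Suc by simp
    then have "\<sigma> ^ (\<Sum>i\<in>UNIV. (m(j := m j - 1)) i) = \<sigma> ^ ?N / \<sigma>"
      using C by (metis nonzero_mult_div_cancel_left order_less_irrefl power_Suc)
    then have "cmod (\<phi> (m(j := m j - 1))) \<le> C * (\<sigma> ^ ?N / \<sigma>)"
      using C(4)[of "m(j := m j - 1)"] by simp
    moreover have "m j \<le> ?N"
      by (rule member_le_sum) auto
    then have "sqrt (real (m j)) \<le> real ?N"
      using sqrt_le_self[of "m j"] by linarith
    ultimately have "cmod (cre j \<phi> m) \<le> real ?N * (C * (\<sigma> ^ ?N / \<sigma>))"
      unfolding cre_def norm_mult by (intro mult_mono) (auto simp del: of_nat_sum)
    also have "\<dots> = C / \<sigma> * (real ?N * \<sigma> ^ ?N)"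
      by simp
    also have "\<dots> \<le> C / \<sigma> * (B * \<tau> ^ ?N)"
      using C B by (intro mult_left_mono) (auto simp del: of_nat_sum)
    finally show ?thesis by simp
  qed
  then show ?thesis
    using B C unfolding geom_decay_def by (meson less_trans)
qed

lemma geom_decay_sqz_prod:
  fixes q :: "'n::finite \<Rightarrow> real"
  shows "geom_decay (sqz_prod q)"
proof -
  \<comment> \<open>Inserting 1/2 keeps the rate positive even if no mode is squeezed.\<close>
  define \<sigma> where "\<sigma> = Max (insert (1 / 2) (range (\<lambda>j. sqrt \<bar>tanh (q j)\<bar>)))"
  have "sqrt \<bar>tanh (q j)\<bar> < 1" for j
    using abs_tanh_less_1 by simp
  then have \<sigma>: "0 < \<sigma>" "\<sigma> < 1"
    by (auto simp: \<sigma>_def Max_gr_iff)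
  have "cmod (sqz_prod q m) \<le> 1 * \<sigma> ^ (\<Sum>j\<in>UNIV. m j)" for m
  proof -
    have "sqrt \<bar>tanh (q j)\<bar> \<le> \<sigma>" for j
      unfolding \<sigma>_def by (rule Max_ge) auto
    then have "\<bar>sqz (q j) (m j)\<bar> \<le> \<sigma> ^ m j" for j
      by (intro order_trans[OF abs_sqz_le] power_mono) auto
    then show ?thesis
      unfolding sqz_prod_def norm_of_real abs_prod power_sum mult_1 by (intro prod_mono) auto
  qed
  with \<sigma> show ?thesis
    unfolding geom_decay_def by blast
qed

text \<open>The dominating function is geometric in the total occupation and so factorises into one
  geometric series per mode.\<close>

lemma geom_decay_summable:
  fixes \<phi> \<psi> :: "('n::finite) state"
  assumes "geom_decay \<phi>" "geom_decay \<psi>"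
  shows "(\<lambda>m. cnj (\<phi> m) * \<psi> m) summable_on UNIV"
proof -
  obtain C \<sigma> where C: "0 \<le> C" "0 < \<sigma>" "\<sigma> < 1" "\<And>m. cmod (\<phi> m) \<le> C * \<sigma> ^ (\<Sum>j\<in>UNIV. m j)"
    using geom_decayE[OF assms(1)] by metis
  obtain D \<tau> where D: "0 \<le> D" "0 < \<tau>" "\<tau> < 1" "\<And>m. cmod (\<psi> m) \<le> D * \<tau> ^ (\<Sum>j\<in>UNIV. m j)"
    using geom_decayE[OF assms(2)] by metis
  have "summable (\<lambda>k. (\<sigma> * \<tau>) ^ k)"
    using C D mult_strict_mono[of \<sigma> 1 \<tau> 1] by (intro summable_geometric) (auto simp: abs_mult)
  then have "(\<lambda>k. \<bar>(\<sigma> * \<tau>) ^ k\<bar>) summable_on UNIV"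
    using C D by (subst summable_on_UNIV_nonneg_real_iff) (auto simp: abs_mult power_abs)
  then have "(\<lambda>m. \<bar>\<Prod>j\<in>UNIV. (\<sigma> * \<tau>) ^ m j\<bar>) summable_on (UNIV :: ('n \<Rightarrow> nat) set)"
    using abs_summable_prod_family[of "\<lambda>_::'n. (\<lambda>k. (\<sigma> * \<tau>) ^ k)"] by simp
  then have "(\<lambda>m. (C * D) * \<bar>\<Prod>j\<in>UNIV. (\<sigma> * \<tau>) ^ m j\<bar>) summable_on (UNIV :: ('n \<Rightarrow> nat) set)"
    by (rule summable_on_cmult_right)
  then have "(\<lambda>m. cmod (cnj (\<phi> m) * \<psi> m)) summable_on UNIV"
  proof (rule summable_on_comparison_test)
    fix m
    have "cmod (cnj (\<phi> m) * \<psi> m) \<le> (C * \<sigma> ^ (\<Sum>j\<in>UNIV. m j)) * (D * \<tau> ^ (\<Sum>j\<in>UNIV. m j))"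
      unfolding norm_mult complex_mod_cnj using C D by (intro mult_mono) auto
    also have "\<dots> = (C * D) * \<bar>\<Prod>j\<in>UNIV. (\<sigma> * \<tau>) ^ m j\<bar>"
    proof -
      have "(\<sigma> * \<tau>) ^ (\<Sum>j\<in>UNIV. m j) = \<bar>\<Prod>j\<in>UNIV. (\<sigma> * \<tau>) ^ m j\<bar>"
        using C D by (simp add: abs_of_nonneg flip: power_sum)
      then show ?thesis
        unfolding power_mult_distrib[of \<sigma> \<tau> "\<Sum>j\<in>UNIV. m j"] by simp
    qed
    finally show "cmod (cnj (\<phi> m) * \<psi> m) \<le> (C * D) * \<bar>\<Prod>j\<in>UNIV. (\<sigma> * \<tau>) ^ m j\<bar>" .
  qed auto
  then show ?thesis
    using summable_on_iff_abs_summable_on_complex by blast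
qed

section \<open>Expectation values in the probe\<close>

text \<open>Terms with \<open>m j = 0\<close> vanish through sqrt 0, and lowering mode j maps the
  remaining occupations bijectively onto all of them. This is the adjointness of \<open>ann\<close>
  and \<open>cre\<close>.\<close>

lemma infsum_shift_mode:
  fixes f g :: "'n state"
  shows "(\<Sum>\<^sub>\<infinity>m. f m * (of_real (sqrt (real (m j))) * g (m(j := m j - 1))))
    = (\<Sum>\<^sub>\<infinity>m. f (m(j := m j + 1)) * (of_real (sqrt (real (m j + 1))) * g m))"
proof -
  have "(\<Sum>\<^sub>\<infinity>m. f m * (of_real (sqrt (real (m j))) * g (m(j := m j - 1))))
      = (\<Sum>\<^sub>\<infinity>m\<in>{m. m j \<noteq> 0}. f m * (of_real (sqrt (real (m j))) * g (m(j := m j - 1))))"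
    by (rule infsum_cong_neutral) auto
  also have "\<dots> = (\<Sum>\<^sub>\<infinity>m. f (m(j := m j + 1)) * (of_real (sqrt (real (m j + 1))) * g m))"
    by (rule infsum_reindex_bij_witness[where i = "\<lambda>m. m(j := m j + 1)" and j = "\<lambda>m. m(j := m j - 1)"]) auto
  finally show ?thesis .
qed

lemma braket_cre: "braket \<phi> (cre j \<psi>) = braket (ann j \<phi>) \<psi>"
  using infsum_shift_mode[of "\<lambda>m. cnj (\<phi> m)" j \<psi>]
  by (simp add: braket_def ann_def cre_def mult_ac del: of_nat_Suc of_nat_add)

lemma braket_ann: "braket \<phi> (ann j \<psi>) = braket (cre j \<phi>) \<psi>"
  using infsum_shift_mode[of \<psi> j "\<lambda>m. cnj (\<phi> m)"]
  by (simp add: braket_def ann_def cre_def mult_ac del: of_nat_Suc of_nat_add)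

lemma braket_cmult_right: "braket \<phi> (\<lambda>m. c * \<psi> m) = c * braket \<phi> \<psi>"
  unfolding braket_def mult.left_commute[of _ c] by (rule infsum_cmult_right')

lemma braket_cmult_left: "braket (\<lambda>m. of_real c * \<phi> m) \<psi> = of_real c * braket \<phi> \<psi>"
  unfolding braket_def complex_cnj_mult complex_cnj_complex_of_real mult.assoc by (rule infsum_cmult_right')

lemma braket_add_right:
  assumes "geom_decay \<phi>" "geom_decay \<psi>" "geom_decay \<eta>"
  shows "braket \<phi> (\<lambda>m. \<psi> m + \<eta> m) = braket \<phi> \<psi> + braket \<phi> \<eta>"
  unfolding braket_def distrib_left
  by (intro infsum_add geom_decay_summable assms)

lemma ann_cre: "ann j (cre k \<psi>) = (\<lambda>m. cre k (ann j \<psi>) m + (if j = k then 1 else 0) * \<psi> m)"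
proof
  fix m
  show "ann j (cre k \<psi>) m = cre k (ann j \<psi>) m + (if j = k then 1 else 0) * \<psi> m"
    using canonical_commutation[of j k \<psi> m] by (auto simp: algebra_simps)
qed

lemma ann_commute: "ann j (ann k \<psi>) = ann k (ann j \<psi>)"
  by (cases "j = k") (auto simp: ann_def fun_eq_iff fun_upd_twist)

lemma cre_commute: "cre j (cre k \<psi>) = cre k (cre j \<psi>)"
  by (cases "j = k") (auto simp: cre_def fun_eq_iff fun_upd_twist)

lemma ann_add: "ann j (\<lambda>m. \<phi> m + \<psi> m) = (\<lambda>m. ann j \<phi> m + ann j \<psi> m)"
  by (auto simp: ann_def algebra_simps)

lemma cre_add: "cre j (\<lambda>m. \<phi> m + \<psi> m) = (\<lambda>m. cre j \<phi> m + cre j \<psi> m)"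
  by (auto simp: cre_def algebra_simps)

lemma ann_cmult: "ann j (\<lambda>m. c * \<psi> m) = (\<lambda>m. c * ann j \<psi> m)"
  by (auto simp: ann_def algebra_simps)

lemma cre_cmult: "cre j (\<lambda>m. c * \<psi> m) = (\<lambda>m. c * cre j \<psi> m)"
  by (auto simp: cre_def algebra_simps)

lemmas geom_decay_intros =
  geom_decay_add geom_decay_cmult geom_decay_ann geom_decay_cre geom_decay_sqz_prod

abbreviation delta :: "'a \<Rightarrow> 'a \<Rightarrow> complex" where
  "delta j k \<equiv> if j = k then 1 else 0"

section \<open>Second and fourth moments of the ladder operators\<close>

lemma cosh_square_eq: "(cosh x)\<^sup>2 * (1 - (tanh x)\<^sup>2) = (1::real)"
proof -
  have "cosh x \<noteq> 0" by simp
  then show ?thesis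
    using hyperbolic_pythagoras[of x] by (simp add: tanh_def power_divide right_diff_distrib)
qed

abbreviation vev :: "('n::finite \<Rightarrow> real) \<Rightarrow> 'n state \<Rightarrow> complex" where
  "vev q \<phi> \<equiv> braket (sqz_prod q) \<phi>"

abbreviation tau :: "('n \<Rightarrow> real) \<Rightarrow> 'n \<Rightarrow> complex" where
  "tau q j \<equiv> of_real (tanh (q j))"

lemma vev_norm: "vev q (sqz_prod q) = 1"
  by (simp add: sqz_prod_inner(2))

text \<open>Adjointness moves the operator to the left vector, the annihilation condition exchanges
  its type there, and adjointness moves it back.\<close>

lemma vev_cre: "vev q (cre j \<phi>) = - tau q j * vev q (ann j \<phi>)"
proof -
  have "vev q (cre j \<phi>) = braket (\<lambda>m. of_real (- tanh (q j)) * cre j (sqz_prod q) m) \<phi>"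
    by (simp add: braket_cre ann_sqz_prod)
  also have "\<dots> = of_real (- tanh (q j)) * vev q (ann j \<phi>)"
    unfolding braket_cmult_left braket_ann ..
  finally show ?thesis by simp
qed

lemma tau_cosh: "(of_real (cosh (q j)))\<^sup>2 * (1 - (tau q j)\<^sup>2) = 1"
  using arg_cong[OF cosh_square_eq[of "q j"], of complex_of_real] by simp

text \<open>Commuting and using the annihilation condition on both sides relates the moment to the
  one with j and k exchanged. For j = k this is solved by 1 - tanh^2 = 1/cosh^2; otherwise two
  exchanges scale the moment by a factor other than 1, so it vanishes.\<close>

lemma vev_ann_cre: "vev q (ann j (cre k (sqz_prod q))) = delta j k * (of_real (cosh (q j)))\<^sup>2"
proof -
  have step: "vev q (ann j (cre k (sqz_prod q))) = tau q j * tau q k * vev q (ann k (cre j (sqz_prod q)))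
      + delta j k" for j k
    unfolding ann_cre[of j k]
    by (simp only: braket_add_right braket_cmult_right geom_decay_intros vev_cre vev_norm
        ann_sqz_prod ann_cmult cre_cmult) simp
  show ?thesis
  proof (cases "j = k")
    case True
    then have "vev q (ann j (cre k (sqz_prod q))) * (1 - (tau q j)\<^sup>2) = 1"
      using step[of j k] by (simp add: power2_eq_square algebra_simps)
    moreover have "1 - (tau q j)\<^sup>2 \<noteq> 0"
      using tau_cosh[of q j] by auto
    ultimately show ?thesis
      using True tau_cosh[of q j] by (metis mult_cancel_right mult_1)
  next
    case False
    let ?t = "tanh (q j) * tanh (q k)"
    have "\<bar>?t\<bar> < 1"
      using mult_strict_mono'[OF abs_tanh_less_1[of "q j"] abs_tanh_less_1[of "q k"]] by (simp add: abs_mult)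
    then have "?t\<^sup>2 \<noteq> 1"
      by (simp add: abs_square_eq_1)
    then have t: "(tau q j * tau q k)\<^sup>2 \<noteq> 1"
      by (metis of_real_1 of_real_eq_iff of_real_mult of_real_power)
    have "vev q (ann j (cre k (sqz_prod q))) = (tau q j * tau q k)\<^sup>2 * vev q (ann j (cre k (sqz_prod q)))"
      using step[of j k] step[of k j] False by (simp add: power2_eq_square mult_ac)
    with t False show ?thesis by simp
  qed
qed

lemma vev_ann_ann: "vev q (ann j (ann k (sqz_prod q))) = - delta j k * tau q j * (of_real (cosh (q j)))\<^sup>2"
  by (simp only: ann_sqz_prod ann_cmult braket_cmult_right vev_ann_cre) simp

lemma vev_cre_ann: "vev q (cre j (ann k (sqz_prod q))) = delta j k * (tau q j * of_real (cosh (q j)))\<^sup>2"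
  by (simp add: vev_cre vev_ann_ann power2_eq_square)

text \<open>
  Wick's theorem for a product of two number-conserving bilinears. Commuting \<open>ann a\<close> through to the
  vacuum, where it turns into \<open>cre a\<close>, and commuting back reproduces the original expectation value,
  with the contractions left over.
\<close>
lemma vev_wick:
  "vev q (cre a (ann b (cre c (ann d (sqz_prod q))))) =
     delta a c * delta b d * of_real (sinh (q a) * cosh (q a) * (sinh (q b) * cosh (q b)))
   + delta a b * delta c d * of_real ((sinh (q a))\<^sup>2 * (sinh (q c))\<^sup>2)
   + delta a d * delta b c * of_real ((sinh (q a))\<^sup>2 * (cosh (q b))\<^sup>2)"
proof -
  let ?Y = "vev q (cre a (ann b (cre c (ann d (sqz_prod q)))))"
  \<comment> \<open>On its way to the right \<open>ann a\<close> fails to commute only with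
    \<open>cre c\<close>.\<close>
  have 1: "ann a (ann b (cre c (ann d (sqz_prod q))))
    = (\<lambda>m. ann b (cre c (ann d (ann a (sqz_prod q)))) m + delta a c * ann b (ann d (sqz_prod q)) m)"
    by (simp only: ann_commute[of a b] ann_cre[of a c] ann_add ann_cmult ann_commute[of a d])
  \<comment> \<open>On its way back \<open>cre a\<close> fails to commute only with
    \<open>ann d\<close> and \<open>ann b\<close>.\<close>
  have 2: "ann b (cre c (ann d (cre a (sqz_prod q))))
    = (\<lambda>m. (cre a (ann b (cre c (ann d (sqz_prod q)))) m
        + delta b a * cre c (ann d (sqz_prod q)) m) + delta d a * ann b (cre c (sqz_prod q)) m)"
    by (simp only: ann_cre[of d a] cre_add cre_cmult ann_add ann_cmult cre_commute[of c a] ann_cre[of b a])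
  have "vev q (ann a (ann b (cre c (ann d (sqz_prod q))))) = - tau q a * (?Y
        + delta b a * vev q (cre c (ann d (sqz_prod q)))
        + delta d a * vev q (ann b (cre c (sqz_prod q))))
      + delta a c * vev q (ann b (ann d (sqz_prod q)))"
    unfolding 1 unfolding ann_sqz_prod[of a] ann_cmult cre_cmult unfolding 2
    by (simp only: braket_add_right braket_cmult_right geom_decay_intros)
  then have "?Y = - tau q a * (- tau q a * (?Y
        + delta b a * vev q (cre c (ann d (sqz_prod q)))
        + delta d a * vev q (ann b (cre c (sqz_prod q))))
      + delta a c * vev q (ann b (ann d (sqz_prod q))))"
    by (simp only: vev_cre[of q a])
  then have "?Y * (1 - (tau q a)\<^sup>2) = (tau q a)\<^sup>2 * (delta a b * vev q (cre c (ann d (sqz_prod q)))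
        + delta a d * vev q (ann b (cre c (sqz_prod q))))
      - tau q a * (delta a c * vev q (ann b (ann d (sqz_prod q))))"
    by (simp add: algebra_simps power2_eq_square eq_commute)
  then have "?Y * ((of_real (cosh (q a)))\<^sup>2 * (1 - (tau q a)\<^sup>2)) = (of_real (cosh (q a)))\<^sup>2 *
     ((tau q a)\<^sup>2 * (delta a b * vev q (cre c (ann d (sqz_prod q)))
        + delta a d * vev q (ann b (cre c (sqz_prod q))))
      - tau q a * (delta a c * vev q (ann b (ann d (sqz_prod q)))))"
    by (simp add: mult_ac)
  moreover have sinh: "complex_of_real (sinh (q j)) = tau q j * of_real (cosh (q j))" for j
    unfolding of_real_mult[symmetric] by (simp add: tanh_def)
  ultimately show ?thesis
    unfolding tau_cosh vev_ann_cre vev_cre_ann vev_ann_ann of_real_mult of_real_power sinh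
    by (auto simp: algebra_simps power2_eq_square)
qed

section \<open>The Fisher matrix\<close>

fun gen_fst :: "'n passive_gen \<Rightarrow> 'n" where
  "gen_fst (Rot j) = j" | "gen_fst (BsX j k) = j" | "gen_fst (BsY j k) = j"

fun gen_snd :: "'n passive_gen \<Rightarrow> 'n" where
  "gen_snd (Rot j) = j" | "gen_snd (BsX j k) = k" | "gen_snd (BsY j k) = k"

fun gen_coeff :: "'n passive_gen \<Rightarrow> complex" where
  "gen_coeff (Rot j) = 1" | "gen_coeff (BsX j k) = 1" | "gen_coeff (BsY j k) = - \<i>"

text \<open>Weight of the bilinear with swapped indices. For \<open>Rot\<close> both bilinears
  coincide, and 0 avoids counting it twice.\<close>

fun gen_coeff' :: "'n passive_gen \<Rightarrow> complex" where
  "gen_coeff' (Rot j) = 0" | "gen_coeff' (BsX j k) = 1" | "gen_coeff' (BsY j k) = \<i>"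

lemma passive_op_eq:
  "passive_op \<mu> \<phi> = (\<lambda>m. gen_coeff \<mu> * cre (gen_fst \<mu>) (ann (gen_snd \<mu>) \<phi>) m
     + gen_coeff' \<mu> * cre (gen_snd \<mu>) (ann (gen_fst \<mu>) \<phi>) m)"
  by (cases \<mu>) (auto simp: fun_eq_iff algebra_simps)

lemma geom_decay_passive_op: "geom_decay \<phi> \<Longrightarrow> geom_decay (passive_op \<mu> \<phi>)"
  unfolding passive_op_eq by (intro geom_decay_intros)

lemma passive_op_add: "passive_op \<mu> (\<lambda>m. \<phi> m + \<psi> m) = (\<lambda>m. passive_op \<mu> \<phi> m + passive_op \<mu> \<psi> m)"
  unfolding passive_op_eq ann_add cre_add by (auto simp: algebra_simps)

lemma passive_op_cmult: "passive_op \<mu> (\<lambda>m. c * \<phi> m) = (\<lambda>m. c * passive_op \<mu> \<phi> m)"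
  unfolding passive_op_eq ann_cmult cre_cmult by (auto simp: algebra_simps)

text \<open>The connected part of Wick's formula: the pairing of a with b and c with d is exactly
  the product of means that the fluctuations subtract.\<close>

definition contraction :: "('n \<Rightarrow> real) \<Rightarrow> 'n \<Rightarrow> 'n \<Rightarrow> 'n \<Rightarrow> 'n \<Rightarrow> complex" where
  "contraction q a b c d =
     delta a c * delta b d * of_real (sinh (q a) * cosh (q a) * (sinh (q b) * cosh (q b)))
   + delta a d * delta b c * of_real ((sinh (q a))\<^sup>2 * (cosh (q b))\<^sup>2)"

definition gen_cov :: "('n \<Rightarrow> real) \<Rightarrow> 'n passive_gen \<Rightarrow> 'n passive_gen \<Rightarrow> complex" where
  "gen_cov q \<mu> \<nu> =
     gen_coeff \<mu> * gen_coeff \<nu> * contraction q (gen_fst \<mu>) (gen_snd \<mu>) (gen_fst \<nu>) (gen_snd \<nu>)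
   + gen_coeff \<mu> * gen_coeff' \<nu> * contraction q (gen_fst \<mu>) (gen_snd \<mu>) (gen_snd \<nu>) (gen_fst \<nu>)
   + gen_coeff' \<mu> * gen_coeff \<nu> * contraction q (gen_snd \<mu>) (gen_fst \<mu>) (gen_fst \<nu>) (gen_snd \<nu>)
   + gen_coeff' \<mu> * gen_coeff' \<nu> * contraction q (gen_snd \<mu>) (gen_fst \<mu>) (gen_snd \<nu>) (gen_fst \<nu>)"

lemma expectation_passive_op:
  "expectation (sqz_prod q) (passive_op \<mu>) =
    (gen_coeff \<mu> + gen_coeff' \<mu>) * delta (gen_fst \<mu>) (gen_snd \<mu>) * of_real ((sinh (q (gen_fst \<mu>)))\<^sup>2)"
proof -
  have "(of_real (tanh (q j)) * of_real (cosh (q j)))\<^sup>2 = complex_of_real ((sinh (q j))\<^sup>2)" for j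
    unfolding of_real_mult[symmetric] of_real_power[symmetric] by (simp add: tanh_def)
  then show ?thesis
    unfolding expectation_def passive_op_eq
    by (simp only: braket_add_right braket_cmult_right geom_decay_intros vev_cre_ann) (simp add: algebra_simps)
qed

lemma braket_passive_op_passive_op:
  "braket (sqz_prod q) (passive_op \<mu> (passive_op \<nu> (sqz_prod q))) =
     gen_cov q \<mu> \<nu> + expectation (sqz_prod q) (passive_op \<mu>) * expectation (sqz_prod q) (passive_op \<nu>)"
proof -
  have "braket (sqz_prod q) (passive_op \<mu> (passive_op \<nu> (sqz_prod q))) =
     gen_coeff \<mu> * (gen_coeff \<nu> * vev q (cre (gen_fst \<mu>) (ann (gen_snd \<mu>) (cre (gen_fst \<nu>) (ann (gen_snd \<nu>) (sqz_prod q)))))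
       + gen_coeff' \<nu> * vev q (cre (gen_fst \<mu>) (ann (gen_snd \<mu>) (cre (gen_snd \<nu>) (ann (gen_fst \<nu>) (sqz_prod q))))))
   + gen_coeff' \<mu> * (gen_coeff \<nu> * vev q (cre (gen_snd \<mu>) (ann (gen_fst \<mu>) (cre (gen_fst \<nu>) (ann (gen_snd \<nu>) (sqz_prod q)))))
       + gen_coeff' \<nu> * vev q (cre (gen_snd \<mu>) (ann (gen_fst \<mu>) (cre (gen_snd \<nu>) (ann (gen_fst \<nu>) (sqz_prod q))))))"
    unfolding passive_op_eq
    by (simp only: ann_add cre_add ann_cmult cre_cmult braket_add_right braket_cmult_right geom_decay_intros)
  then show ?thesis
    unfolding vev_wick expectation_passive_op gen_cov_def contraction_def
    by (simp only:) (auto simp: algebra_simps power2_eq_square)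
qed

lemma fluctuation_eq:
  "fluctuation \<psi> (passive_op \<mu>) \<phi> = (\<lambda>m. passive_op \<mu> \<phi> m + (- expectation \<psi> (passive_op \<mu>)) * \<phi> m)"
  by (simp add: fluctuation_def fun_eq_iff)

lemma braket_fluctuation_fluctuation:
  "braket (sqz_prod q) (fluctuation (sqz_prod q) (passive_op \<mu>)
     (fluctuation (sqz_prod q) (passive_op \<nu>) (sqz_prod q))) = gen_cov q \<mu> \<nu>"
  unfolding fluctuation_eq passive_op_add passive_op_cmult
  by (simp only: braket_add_right braket_cmult_right geom_decay_intros geom_decay_passive_op
      braket_passive_op_passive_op vev_norm flip: expectation_def) (simp add: algebra_simps)

lemma passive_fisher_eq:
  "passive_fisher r \<mu> \<nu> = 2 * (gen_cov (($) r) \<mu> \<nu> + gen_cov (($) r) \<nu> \<mu>)"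
proof -
  let ?\<Delta> = "\<lambda>\<mu>. fluctuation (sqz_prod (($) r)) (passive_op \<mu>)"
  have "geom_decay (?\<Delta> \<mu> (?\<Delta> \<nu> (sqz_prod (($) r))))" for \<mu> \<nu>
    unfolding fluctuation_eq by (intro geom_decay_intros geom_decay_passive_op)
  then show ?thesis
    unfolding passive_fisher_def probe_eq_sqz_prod expectation_def anticommutator_def[abs_def]
    by (simp only: braket_add_right geom_decay_sqz_prod braket_fluctuation_fluctuation)
qed

text \<open>A contraction needs the same unordered index pair, so only \<open>BsX j k\<close>
  against \<open>BsY j k\<close> can contribute. That covariance is imaginary, plus or minus
  \<open>\<i>\<close> times sinh^2 r_j - sinh^2 r_k, and changes sign with the operator order, so
  the anticommutator cancels it.\<close>

lemma passive_fisher_off_diagonal: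
  assumes "\<mu> \<in> passive_basis" "\<nu> \<in> passive_basis" "\<mu> \<noteq> \<nu>"
  shows "passive_fisher r \<mu> \<nu> = 0"
  using assms unfolding passive_fisher_eq gen_cov_def contraction_def passive_basis_def
  by (cases \<mu>; cases \<nu>) (auto simp: algebra_simps)

text \<open>Equal and swapped pairs coincide, so the variance is 2 (sinh cosh)^2; the doubling
  formula turns four times this into the constant 2.\<close>

lemma passive_fisher_Rot: "passive_fisher r (Rot j) (Rot j) = of_real (2 * (sinh (2 * r $ j))\<^sup>2)"
  unfolding passive_fisher_eq gen_cov_def contraction_def sinh_double
  by (simp add: power2_eq_square algebra_simps)

text \<open>Swapped pairs give the squares and equal pairs the cross term of the expanded sinh^2
  (r_j + r_k). For \<open>BsY\<close> the phases reverse the sign of the cross term.\<close>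

lemma passive_fisher_BsX:
  assumes "j \<noteq> k"
  shows "passive_fisher r (BsX j k) (BsX j k) = of_real (4 * (sinh (r $ j + r $ k))\<^sup>2)"
  using assms unfolding passive_fisher_eq gen_cov_def contraction_def sinh_add
  by (simp add: power2_eq_square algebra_simps)

lemma passive_fisher_BsY:
  assumes "j \<noteq> k"
  shows "passive_fisher r (BsY j k) (BsY j k) = of_real (4 * (sinh (r $ j - r $ k))\<^sup>2)"
  using assms unfolding passive_fisher_eq gen_cov_def contraction_def sinh_diff
  by (simp add: power2_eq_square algebra_simps)

section \<open>Positive restricted roots of type C_n\<close>

lemma root_apply:
  "long_root j r = 2 * r $ j" "diff_root j k r = r $ j - r $ k" "sum_root j k r = r $ j + r $ k"
  by (simp_all add: long_root_def diff_root_def sum_root_def)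

text \<open>Values at the unit vectors read off the coefficients of a root. For sum roots the
  ordering of the indices excludes the swapped solution.\<close>

lemma root_eq_iff:
  fixes j k j' k' :: "'n::{finite,linorder}"
  shows "long_root j = long_root j' \<longleftrightarrow> j = j'"
    and "j < k \<Longrightarrow> long_root j' \<noteq> diff_root j k"
    and "j < k \<Longrightarrow> long_root j' \<noteq> sum_root j k"
    and "j < k \<Longrightarrow> j' < k' \<Longrightarrow> diff_root j k \<noteq> sum_root j' k'"
    and "j < k \<Longrightarrow> j' < k' \<Longrightarrow> diff_root j k = diff_root j' k' \<longleftrightarrow> j = j' \<and> k = k'"
    and "j < k \<Longrightarrow> j' < k' \<Longrightarrow> sum_root j k = sum_root j' k' \<longleftrightarrow> j = j' \<and> k = k'"
proof -
  have ax: "axis i (1::real) $ l = (if l = i then 1 else 0)" for i l :: 'n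
    by (auto simp: axis_def)
  have ev: "f (axis i 1) = g (axis i 1)" if "f = g" for f g :: "real ^ 'n::{finite,linorder} \<Rightarrow> real" and i
    using that by simp
  show "long_root j = long_root j' \<longleftrightarrow> j = j'"
    by (auto simp: root_apply ax split: if_splits dest: ev[where i = j])
  show "long_root j' \<noteq> diff_root j k" if "j < k"
    using that by (auto simp: root_apply ax split: if_splits dest!: ev[where i = k])
  show "long_root j' \<noteq> sum_root j k" if "j < k"
  proof
    assume "long_root j' = sum_root j k"
    from ev[OF this, of k] ev[OF this, of j] that show False
      by (auto simp: root_apply ax split: if_splits)
  qed
  show "diff_root j k \<noteq> sum_root j' k'" if "j < k" "j' < k'"
    using that by (auto simp: root_apply ax split: if_splits dest!: ev[where i = k])
  show "diff_root j k = diff_root j' k' \<longleftrightarrow> j = j' \<and> k = k'" if "j < k" "j' < k'"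
  proof
    assume "diff_root j k = diff_root j' k'"
    from ev[OF this, of k] ev[OF this, of j] that show "j = j' \<and> k = k'"
      by (auto simp: root_apply ax split: if_splits)
  qed simp
  show "sum_root j k = sum_root j' k' \<longleftrightarrow> j = j' \<and> k = k'" if "j < k" "j' < k'"
  proof
    assume "sum_root j k = sum_root j' k'"
    from ev[OF this, of k] ev[OF this, of j] that show "j = j' \<and> k = k'"
      by (auto simp: root_apply ax split: if_splits)
  qed simp
qed

text \<open>Makes \<open>gen_of_root\<close> a genuine inverse of the labelling.\<close>

lemma bij_betw_root_of: "bij_betw root_of (passive_basis :: 'n::{finite,linorder} passive_gen set) positive_roots"
  unfolding bij_betw_def
proof
  show "inj_on root_of (passive_basis :: 'n passive_gen set)"
    by (rule inj_onI) (auto simp: passive_basis_def root_eq_iff root_eq_iff(2-4)[THEN not_sym])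
  show "root_of ` (passive_basis :: 'n passive_gen set) = positive_roots"
  proof -
    have "root_of ` range Rot = (range long_root :: (real ^ 'n::{finite,linorder} \<Rightarrow> real) set)"
      "root_of ` {BsX j k | j k. j < k} = {sum_root j k | (j::'n) k. j < k}"
      "root_of ` {BsY j k | j k. j < k} = {diff_root j k | (j::'n) k. j < k}"
      by force+
    then show ?thesis
      by (simp add: passive_basis_def positive_roots_def image_Un Un_ac)
  qed
qed

lemma root_coeff_simps:
  fixes j k :: "'n::{finite,linorder}"
  shows "root_coeff (long_root j) = 2"
    and "j < k \<Longrightarrow> root_coeff (diff_root j k) = 4"
    and "j < k \<Longrightarrow> root_coeff (sum_root j k) = 4"
  using root_eq_iff(2,3)[of j k] by (auto simp: root_coeff_def) metis+

lemma root_fisher_root_of: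
  assumes "\<mu> \<in> passive_basis"
  shows "root_fisher (root_of \<mu>) r = passive_fisher r \<mu> \<mu>"
  using the_inv_into_f_f[OF bij_betw_imp_inj_on[OF bij_betw_root_of] assms]
  by (simp add: root_fisher_def gen_of_root_def)

lemma root_fisher_eq:
  assumes "\<alpha> \<in> positive_roots"
  shows "root_fisher \<alpha> r = of_real (root_coeff \<alpha> * (sinh (\<alpha> r))\<^sup>2)"
proof -
  obtain \<mu> where \<mu>: "\<mu> \<in> passive_basis" "\<alpha> = root_of \<mu>"
    using assms bij_betw_imp_surj_on[OF bij_betw_root_of] by blast
  then show ?thesis
    unfolding \<mu>(2) root_fisher_root_of[OF \<mu>(1)]
    by (cases \<mu>) (auto simp: passive_basis_def passive_fisher_Rot passive_fisher_BsX passive_fisher_BsY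
        root_coeff_simps root_apply)
qed

theorem propositionS13:
  fixes r :: "real ^ 'n::{finite,linorder}"
  shows "(\<forall>\<mu>\<in>passive_basis. \<forall>\<nu>\<in>passive_basis. \<mu> \<noteq> \<nu> \<longrightarrow> passive_fisher r \<mu> \<nu> = 0) \<and>
    (\<forall>j. passive_fisher r (Rot j) (Rot j) = of_real (2 * (sinh (2 * r $ j))\<^sup>2)) \<and>
    (\<forall>j k. j < k \<longrightarrow>
      passive_fisher r (BsY j k) (BsY j k) = of_real (4 * (sinh (r $ j - r $ k))\<^sup>2) \<and>
      passive_fisher r (BsX j k) (BsX j k) = of_real (4 * (sinh (r $ j + r $ k))\<^sup>2)) \<and>
    bij_betw root_of (passive_basis :: 'n passive_gen set) positive_roots \<and>
    (\<forall>\<alpha>\<in>positive_roots. root_fisher \<alpha> r = of_real (root_coeff \<alpha> * (sinh (\<alpha> r))\<^sup>2)) \<and>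
    (\<forall>j::'n. root_coeff (long_root j) = 2) \<and>
    (\<forall>(j::'n) k. j < k \<longrightarrow> root_coeff (diff_root j k) = 4 \<and> root_coeff (sum_root j k) = 4)"
  by (intro conjI ballI allI impI passive_fisher_off_diagonal passive_fisher_Rot passive_fisher_BsX
      passive_fisher_BsY bij_betw_root_of root_fisher_eq root_coeff_simps) auto

end
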